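(* Almost everywhere, $\lim_{n\to\infty}\frac{\mathsf a'_n}{\sum_{k=1}^{n-1}\mathsf a_k}=0$. More generally, let $g:[0,\infty)\to(3,\infty)$ be measurable with the property that $g(\eta(t))\asymp g(t)$ whenever $\eta(t)\sim t$ as $t\to\infty$. Then for some (any sufficiently large) $c>1$, \[ \limsup_{n\to\infty}\frac{g(\mathsf a'_n)}{\sum_{k=1}^{n-1}\mathsf a_k}=\infty\ \text{a.e.}\quad\Longleftrightarrow\quad\int_c^\infty\frac{g(y)}{\log g(y)}\frac{dy}{y^2\log y}=\infty, \] while if the integral is finite, $\lim_{n\to\infty}\frac{g(\mathsf a'_n)}{\sum_{k=1}^{n-1}\mathsf a_k}=0$ a.e.
   Context: $I=(0,1]$, "a.e." refers to Lebesgue measure on $I$, $\mathsf a_n(x)$ denotes the $n$-th continued fraction digit of $x\in I$. $\mathbb P$ is the set of primes. The prime digits are $\mathsf a'_n(x):=\mathsf a_n(x)$ if $\mathsf a_n(x)\in\mathbb P$ and $\mathsf a'_n(x):=0$ otherwise. $g(t)\sim h(t)$ means $g(t)/h(t)\to1$; $g(t)\asymp h(t)$ means $0<\liminf_{t\to\infty}g(t)/h(t)\le\limsup_{t\to\infty}g(t)/h(t)<\infty$. *)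

theory Defs
  imports "HOL-Analysis.Analysis" "HOL-Computational_Algebra.Primes"
begin

text \<open>Gauss map on (0,1]; by Isabelle's convention 1/0 = 0, so the map sends 0 to 0.\<close>
definition gauss_map :: "real \<Rightarrow> real" where
  "gauss_map x = frac (1 / x)"

text \<open>n-th continued fraction digit (n \<ge> 1): a_n(x) = floor(1 / T^(n-1) x).
  For rational x the expansion terminates and later digits are 0 (a null set).\<close>
definition cf_digit :: "nat \<Rightarrow> real \<Rightarrow> nat" where
  "cf_digit n x = nat \<lfloor>1 / (gauss_map ^^ (n - 1)) x\<rfloor>"

definition prime_digit :: "nat \<Rightarrow> real \<Rightarrow> nat" where
  "prime_digit n x = (if prime (cf_digit n x) then cf_digit n x else 0)"

definition asymp_comparable :: "(real \<Rightarrow> real) \<Rightarrow> (real \<Rightarrow> real) \<Rightarrow> bool" where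
  "asymp_comparable f h \<longleftrightarrow>
     0 < Liminf at_top (\<lambda>t. ereal (f t / h t)) \<and>
     Liminf at_top (\<lambda>t. ereal (f t / h t)) \<le> Limsup at_top (\<lambda>t. ereal (f t / h t)) \<and>
     Limsup at_top (\<lambda>t. ereal (f t / h t)) < \<infinity>"

end

theory Submission
  imports Defs
begin

text \<open>
  Under Lebesgue measure the conditional law of \<open>T\<^sup>n x\<close> given the first \<open>n\<close> digits has density
  \<open>(1 + s) / (1 + s y)\<^sup>2\<close> on \<open>(0,1)\<close>, where \<open>s = q\<^bsub>n-1\<^esub> / q\<^bsub>n\<^esub>\<close>, and reading one more digit \<open>m\<close>
  replaces \<open>s\<close> by \<open>1 / (m + s)\<close>. Hence the next digit equals \<open>m\<close> with conditional probability
  between \<open>1 / (3 m\<^sup>2)\<close> and \<open>2 / m\<^sup>2\<close>, whatever the past, so the digits can be treated like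
  independent ones up to constants.

  A Chernoff bound gives \<open>a\<^sub>1 + \<dots> + a\<^sub>n \<ge> c n log n\<close> eventually, almost everywhere. By Chebyshev's
  estimates, \<open>\<Sum>\<^sub>n P(g(a'\<^sub>n) \<ge> M n log n)\<close> converges iff the integral does, for every \<open>M > 0\<close>. If it
  converges, the first Borel-Cantelli lemma gives the limit 0. If it diverges, then after any time
  \<open>N\<close> there is a first \<open>n\<close> with \<open>g(a'\<^sub>n) \<ge> M n log n\<close>; conditionally on its value, truncation and
  Markov's inequality show that the preceding digit sum is at most \<open>K\<^sup>2 n log n\<close> with probability at
  least \<open>1 - 72 / K\<close>, where \<open>M / K\<^sup>2\<close> may still be chosen arbitrarily large.
\<close>

section \<open>Chebyshev estimates\<close>

text \<open>The divergent half cannot be settled by treating the prime digits and the digit sum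
  separately: almost everywhere the sum exceeds every multiple of n log n infinitely often, because
  the series of 1/(n log n) diverges. Large prime digits must be found at times when the sum before
  them has normal size, hence the bound conditional on the first exceedance.

  Since \<open>g\<close> is not assumed monotone, the primes p with g(p) \<ge> z need not form a
  tail. The series is therefore summed prime by prime: p is counted once for every n with M n log n
  \<le> g(p), about g(p)/log g(p) times, with probability of order 1/p^2. This is the origin of
  g/log g in the integral; the rest, 1/(y^2 log y), is that probability times the density of the
  primes.

  The hypothesis on \<open>g\<close> bounds each eta separately. A constant uniform on [y, 16 y] is
  extracted by contradiction, gluing counterexamples into one eta. The ratio is 16 because the
  elementary Chebyshev constants are too far apart for dyadic blocks.\<close>

lemma multiplicity_fact_legendre:
  fixes p n L :: nat
  assumes p: "prime p" and "n < p ^ (Suc L)"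
  shows "multiplicity p (fact n) = (\<Sum>i=1..L. n div p ^ i)"
  using assms(2)
proof (induction n)
  case 0 then show ?case by simp
next
  case (Suc n)
  have "multiplicity p (fact (Suc n)) = multiplicity p (Suc n) + multiplicity p (fact n :: nat)"
    using p by (simp del: mult_Suc add: prime_elem_multiplicity_mult_distrib)
  also have "multiplicity p (Suc n) = card {i\<in>{1..L}. p ^ i dvd Suc n}"
  proof -
    have "{i\<in>{1..L}. p ^ i dvd Suc n} = {1..multiplicity p (Suc n)}"
    proof -
      have *: "p ^ i dvd Suc n \<longleftrightarrow> i \<le> multiplicity p (Suc n)" for i
        using p by (intro power_dvd_iff_le_multiplicity) auto
      have "p ^ multiplicity p (Suc n) \<le> Suc n"
        by (rule dvd_imp_le) (auto simp: multiplicity_dvd)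
      then have "p ^ multiplicity p (Suc n) < p ^ Suc L" using Suc.prems by linarith
      then have "multiplicity p (Suc n) < Suc L"
        using p prime_gt_1_nat power_less_imp_less_exp by blast
      then show ?thesis unfolding * by auto
    qed
    then show ?thesis by simp
  qed
  also have "\<dots> = (\<Sum>i=1..L. if p ^ i dvd Suc n then 1 else 0)"
    by (simp add: sum.If_cases Int_def)
  also have "multiplicity p (fact n) = (\<Sum>i=1..L. n div p ^ i)" using Suc by simp
  also have "(\<Sum>i=1..L. if p ^ i dvd Suc n then 1 else 0) + (\<Sum>i=1..L. n div p ^ i)
      = (\<Sum>i=1..L. Suc n div p ^ i)"
    unfolding sum.distrib[symmetric] by (rule sum.cong) (auto simp: div_Suc dvd_eq_mod_eq_0)
  finally show ?case .
qed

text \<open>In Legendre's formula each term \<open>(2 * n) div p ^ i - 2 * (n div p ^ i)\<close> is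
  0 or 1, and no term survives beyond the largest \<open>L\<close> with
  \<open>p ^ L \<le> 2 * n\<close>; so the exponent of \<open>p\<close> is at most
  \<open>L\<close>.\<close>

lemma prime_power_central_binomial_le:
  fixes p n :: nat
  assumes p: "prime p" and n: "n > 0"
  shows "p ^ multiplicity p ((2 * n) choose n) \<le> 2 * n"
proof -
  have p1: "p > 1" using p prime_gt_1_nat by blast
  \<comment> \<open>One cutoff \<open>L\<close> serves both \<open>n\<close> and
    \<open>2 * n\<close>, so that the two Legendre sums have the same range.\<close>
  obtain L where L: "p ^ L \<le> 2 * n" "2 * n < p ^ Suc L"
    using ex_power_ivl1[of p "2*n"] p1 n by auto
  have nL: "n < p ^ Suc L" using L by linarith
  have "fact (2 * n) = (fact n * fact n) * ((2 * n) choose n)"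
    using binomial_fact_lemma[of n "2 * n"] by simp
  then have "multiplicity p (fact (2 * n) :: nat)
      = multiplicity p (fact n :: nat) + multiplicity p (fact n :: nat) + multiplicity p ((2 * n) choose n)"
    using p by (simp add: prime_elem_multiplicity_mult_distrib)
  then have "multiplicity p ((2 * n) choose n) + (\<Sum>i=1..L. 2 * (n div p ^ i)) = (\<Sum>i=1..L. (2 * n) div p ^ i)"
    using multiplicity_fact_legendre[OF p nL] multiplicity_fact_legendre[OF p L(2)]
    by (simp add: sum_distrib_left[symmetric])
  also have "\<dots> \<le> (\<Sum>i=1..L. 1 + 2 * (n div p ^ i))"
  proof (rule sum_mono)
    fix i
    have q: "p ^ i > 0" using p1 by simp
    have "n < (n div p ^ i + 1) * p ^ i"
      using q by (metis Suc_eq_plus1 dividend_less_div_times mult.commute mult_Suc_right plus_1_eq_Suc add.commute)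
    then have "2 * n < (2 + 2 * (n div p ^ i)) * p ^ i" by (simp add: algebra_simps)
    then have "(2 * n) div p ^ i < 2 + 2 * (n div p ^ i)"
      by (simp add: less_mult_imp_div_less)
    then show "(2 * n) div p ^ i \<le> 1 + 2 * (n div p ^ i)" by simp
  qed
  also have "\<dots> = L + (\<Sum>i=1..L. 2 * (n div p ^ i))" by (simp only: sum.distrib) simp
  finally have "multiplicity p ((2 * n) choose n) \<le> L" by simp
  then have "p ^ multiplicity p ((2 * n) choose n) \<le> p ^ L"
    using p1 by (intro power_increasing) auto
  then show ?thesis using L by linarith
qed

section \<open>Chebyshev bounds along powers of two\<close>

definition prime_count :: "nat \<Rightarrow> nat" where
  "prime_count n = card {p. prime p \<and> p \<le> n}"

lemma prime_count_diff:
  "m \<le> n \<Longrightarrow> card {p. prime p \<and> m < p \<and> p \<le> n} = prime_count n - prime_count m"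
proof -
  assume "m \<le> n"
  then have "{p. prime p \<and> m < p \<and> p \<le> n} = {p. prime p \<and> p \<le> n} - {p. prime p \<and> p \<le> m}" by auto
  also have "card \<dots> = prime_count n - prime_count m"
    unfolding prime_count_def using \<open>m \<le> n\<close> by (subst card_Diff_subset) auto
  finally show ?thesis .
qed

text \<open>Every prime power in the central binomial coefficient is at most
  \<open>2 * n = 2 ^ k\<close>, so the coefficient is at most
  \<open>2 ^ (k * prime_count (2 ^ k))\<close>; it is also at least \<open>4 ^ n / (2 * n)\<close>.
  After comparing exponents of 2, this denominator accounts for the \<open>+ 1\<close>.\<close>

lemma prime_count_pow2_lower: "2 ^ k \<le> k * (prime_count (2 ^ k) + 1)" if "k \<ge> 1"
proof -
  define n :: nat where "n = 2 ^ (k - 1)"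
  have n: "n > 0" "2 * n = 2 ^ k" using that by (cases k; simp add: n_def)+
  let ?C = "(2 * n) choose n"
  have C0: "?C > 0" by simp
  have "?C = (\<Prod>p\<in>prime_factors ?C. p ^ multiplicity p ?C)"
    using C0 prime_factorization_nat by blast
  also have "\<dots> \<le> (\<Prod>p\<in>prime_factors ?C. 2 * n)"
    using prime_power_central_binomial_le[OF _ n(1)] by (intro prod_mono) (auto simp del: n(2))
  also have "\<dots> = (2 * n) ^ card (prime_factors ?C)" by simp
  also have "card (prime_factors ?C) \<le> prime_count (2 * n)"
    unfolding prime_count_def
  proof (rule card_mono)
    show "prime_factors ?C \<subseteq> {p. prime p \<and> p \<le> 2 * n}"
    proof
      fix p assume "p \<in> prime_factors ?C"
      then have p: "prime p" "p dvd ?C" by (auto simp: in_prime_factors_iff)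
      have "multiplicity p ?C \<ge> 1"
        using p C0 by (simp add: Suc_le_eq prime_multiplicity_gt_zero_iff)
      then have "p ^ 1 \<le> p ^ multiplicity p ?C" using p prime_gt_0_nat
        by (intro power_increasing) (auto simp: Suc_leI)
      with prime_power_central_binomial_le[OF p(1) n(1)] p show "p \<in> {p. prime p \<and> p \<le> 2 * n}" by auto
    qed
  qed auto
  then have "(2 * n) ^ card (prime_factors ?C) \<le> (2 * n) ^ prime_count (2 * n)"
    using n by (intro power_increasing) auto
  finally have up: "?C \<le> 2 ^ (k * prime_count (2 ^ k))" unfolding n(2) by (simp add: power_mult)
  have "4 ^ n / (2 * real n) \<le> real ?C" by (rule central_binomial_lower_bound[OF n(1)])
  then have "(4::real) ^ n \<le> real ?C * 2 ^ k"
  proof -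
    have "2 * real n = 2 ^ k" using n(2) by (metis of_nat_mult of_nat_numeral of_nat_power)
    with \<open>4 ^ n / (2 * real n) \<le> real ?C\<close> show ?thesis by (simp add: field_simps)
  qed
  also have "\<dots> \<le> real (2 ^ (k * prime_count (2 ^ k))) * 2 ^ k"
    using up by (intro mult_right_mono) (auto simp del: of_nat_power)
  also have "\<dots> = 2 ^ (k * (prime_count (2 ^ k) + 1))" by (simp add: power_add algebra_simps)
  also have "(4::real) ^ n = 2 ^ (2 ^ k)" unfolding n(2)[symmetric] by (simp add: power_mult)
  finally have "(2::real) ^ (2 ^ k) \<le> 2 ^ (k * (prime_count (2 ^ k) + 1))" .
  then show ?thesis by (subst (asm) power_increasing_iff) auto
qed

text \<open>With \<open>n = 2 ^ k\<close>, all primes in \<open>(n, 2 * n]\<close> divide the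
  central binomial coefficient, which is at most \<open>4 ^ n\<close>, and each of them exceeds
  \<open>n\<close>.\<close>

lemma prime_count_pow2_step: "k * (prime_count (2 ^ Suc k) - prime_count (2 ^ k)) \<le> 2 * 2 ^ k"
proof -
  define n :: nat where "n = 2 ^ k"
  have n: "n > 0" by (simp add: n_def)
  define Q where "Q = {p. prime p \<and> n < p \<and> p \<le> 2 * n}"
  have fin: "finite Q" unfolding Q_def by simp
  have dv: "p dvd ((2 * n) choose n)" if "p \<in> Q" for p
  proof -
    have p: "prime p" "n < p" "p \<le> 2 * n" using that by (auto simp: Q_def)
    have "p dvd fact (2 * n)" using p prime_dvd_fact_iff by blast
    moreover have "fact (2 * n) = (fact n * fact n) * ((2 * n) choose n)"
      using binomial_fact_lemma[of n "2 * n"] by simp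
    moreover have "\<not> p dvd fact n" using p prime_dvd_fact_iff by (metis not_le)
    ultimately show ?thesis using p prime_dvd_mult_iff by (metis (no_types))
  qed
  have "n ^ card Q = (\<Prod>p\<in>Q. n)" by simp
  also have "\<dots> \<le> \<Prod>Q" by (intro prod_mono) (auto simp: Q_def)
  also have "\<Prod>Q dvd ((2 * n) choose n)"
  proof -
    have "\<Prod>R dvd ((2 * n) choose n)" if "R \<subseteq> Q" for R
      using finite_subset[OF that fin] that
    proof (induction R rule: finite_induct)
      case (insert p R)
      have "coprime p (\<Prod>R)"
        using insert by (intro prod_coprime_right) (auto simp: Q_def intro!: primes_coprime)
      then show ?case using insert dv by (simp add: divides_mult)
    qed simp
    then show ?thesis by blast
  qed
  then have "\<Prod>Q \<le> (2 * n) choose n" by (rule dvd_imp_le) simp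
  also have "\<dots> \<le> 2 ^ (2 * n)" by (rule binomial_le_pow2)
  finally have "(2::nat) ^ (k * card Q) \<le> 2 ^ (2 * n)" by (simp add: n_def power_mult)
  then have "k * card Q \<le> 2 * n" by (subst (asm) power_increasing_iff) auto
  then show ?thesis
    using prime_count_diff[of n "2 * n"] unfolding Q_def n_def by simp
qed

lemma prime_count_mono: "m \<le> n \<Longrightarrow> prime_count m \<le> prime_count n"
  unfolding prime_count_def by (intro card_mono) auto

text \<open>The doubling step raises the constant from 6 to 8, and passing from \<open>k\<close> to
  \<open>Suc k\<close> in front costs at most 3/2 once \<open>k \<ge> 2\<close>. The constant 6 is
  the fixed point of this recursion: \<open>(6 + 2) * 3 / 2 = 2 * 6\<close>.\<close>

lemma prime_count_pow2_upper: "k * prime_count (2 ^ k) \<le> 6 * 2 ^ k"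
proof (induction k)
  case 0 show ?case by simp
next
  case (Suc k)
  have le: "prime_count n \<le> n" for n
    unfolding prime_count_def using card_mono[of "{1..n}" "{p. prime p \<and> p \<le> n}"]
    by (force simp: Suc_le_eq prime_gt_0_nat)
  show ?case
  \<comment> \<open>Here \<open>Suc k \<le> 2\<close>, and the trivial bound
    \<open>prime_count n \<le> n\<close> suffices.\<close>
  proof (cases "k < 2")
    case True
    then have "Suc k * prime_count (2 ^ Suc k) \<le> 2 * 2 ^ Suc k"
      using le[of "2 ^ Suc k"] by (intro mult_mono) auto
    then show ?thesis by (simp)
  next
    case False
    have "k * prime_count (2 ^ Suc k) \<le> 8 * 2 ^ k"
      using prime_count_pow2_step[of k] Suc prime_count_mono[of "2 ^ k" "2 ^ Suc k"]
      by (simp add: diff_mult_distrib2)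
    then have "2 * (Suc k * prime_count (2 ^ Suc k)) \<le> 3 * (8 * 2 ^ k)"
    proof -
      have "2 * Suc k \<le> 3 * k" using False by simp
      then have "2 * Suc k * prime_count (2 ^ Suc k) \<le> 3 * k * prime_count (2 ^ Suc k)"
        by (rule mult_right_mono) simp
      also have "\<dots> \<le> 3 * (8 * 2 ^ k)"
        using \<open>k * prime_count (2 ^ Suc k) \<le> 8 * 2 ^ k\<close> by (metis mult.assoc mult_le_mono2)
      finally show ?thesis by (simp only: mult.assoc)
    qed
    then show ?thesis by simp
  qed
qed

section \<open>Primes in blocks of ratio 16\<close>

lemma two_power_four_mult:
  "(2::'a::comm_semiring_1) ^ (4 * j) = 16 ^ j" "(2::'a) ^ (4 * j + 4) = 16 ^ Suc j"
proof -
  show *: "(2::'a::comm_semiring_1) ^ (4 * j) = 16 ^ j" by (simp add: power_mult)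
  then show "(2::'a) ^ (4 * j + 4) = 16 ^ Suc j" by (simp add: power_add * mult.commute)
qed

definition prime_block :: "nat \<Rightarrow> nat set" where
  "prime_block j = {p. prime p \<and> 16 ^ j < p \<and> p \<le> 16 ^ Suc j}"

lemma finite_prime_block [simp]: "finite (prime_block j)"
  unfolding prime_block_def by simp

lemma card_prime_block: "card (prime_block j) = prime_count (2 ^ (4 * j + 4)) - prime_count (2 ^ (4 * j))"
  unfolding prime_block_def two_power_four_mult by (subst prime_count_diff) auto

lemma card_prime_block_upper: "j * card (prime_block j) \<le> 24 * 16 ^ j"
proof -
  have "4 * (j * card (prime_block j)) \<le> (4 * j + 4) * prime_count (2 ^ (4 * j + 4))"
    unfolding card_prime_block by (simp add: algebra_simps trans_le_add1)
  also have "\<dots> \<le> 6 * 2 ^ (4 * j + 4)" by (rule prime_count_pow2_upper)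
  also have "\<dots> = 4 * (24 * 16 ^ j)" by (simp add: two_power_four_mult)
  finally show ?thesis by simp
qed

text \<open>As \<open>4 * j + 4 \<le> 8 * j\<close>, the lower bound at the right end yields
  \<open>8 * q\<close> with \<open>q = 16 ^ j\<close>. The primes up to the left end take away at
  most \<open>6 * q\<close>, and the \<open>+ 1\<close> in the lower bound at most another
  \<open>q\<close>; one \<open>q\<close> remains.\<close>

lemma card_prime_block_lower: "16 ^ j \<le> 4 * j * card (prime_block j)" if "j \<ge> 1"
proof -
  define A B q where "A = real (prime_count (2 ^ (4 * j + 4)))" and "B = real (prime_count (2 ^ (4 * j)))"
    and "q = (16::real) ^ j"
  have "real (2 ^ (4 * j + 4)) \<le> real ((4 * j + 4) * (prime_count (2 ^ (4 * j + 4)) + 1))"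
    using prime_count_pow2_lower[of "4 * j + 4"] by (simp only: of_nat_le_iff)
  then have 1: "16 * q \<le> (4 * j + 4) * (A + 1)"
    by (simp add: A_def q_def two_power_four_mult) (simp add: algebra_simps)
  have "real (4 * j * prime_count (2 ^ (4 * j))) \<le> real (6 * 2 ^ (4 * j))"
    using prime_count_pow2_upper[of "4 * j"] by (simp only: of_nat_le_iff)
  then have 2: "4 * j * B \<le> 6 * q" by (simp add: B_def q_def two_power_four_mult)
  have q: "4 * j \<le> q"
  proof -
    have "4 * Suc i \<le> (16::nat) ^ Suc i" for i
    proof (induction i)
      case (Suc i)
      moreover have "1 \<le> (16::nat) ^ Suc i" by (rule one_le_power) simp
      moreover have "4 * Suc i \<le> q \<Longrightarrow> 1 \<le> q \<Longrightarrow> 4 * Suc (Suc i) \<le> 16 * q" for q by simp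
      ultimately show ?case by (subst power_Suc) blast
    qed simp
    from this[of "j - 1"] have "4 * j \<le> (16::nat) ^ j" using that by simp
    then have "real (4 * j) \<le> real (16 ^ j)" by (simp only: of_nat_le_iff)
    then show ?thesis by (simp add: q_def)
  qed
  have j: "real j \<ge> 1" using that by simp
  have A: "A + 1 \<ge> 0" by (simp add: A_def)
  have "(4 * j + 4) * (A + 1) \<le> (8 * j) * (A + 1)" using j A by (intro mult_right_mono) auto
  then have "8 * q \<le> 4 * j * A + 4 * j" using 1 by (simp add: algebra_simps)
  then have "q \<le> 4 * j * (A - B)" using 2 q by (simp add: algebra_simps)
  moreover have "real (card (prime_block j)) = A - B"
    unfolding card_prime_block A_def B_def by (intro of_nat_diff prime_count_mono) simp
  ultimately have "real (16 ^ j) \<le> real (4 * j * card (prime_block j))" by (simp add: q_def)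
  then show ?thesis by (simp only: of_nat_le_iff)
qed

section \<open>The digit process\<close>

definition gdens :: "real \<Rightarrow> real \<Rightarrow> real" where
  "gdens s x = (1 + s) / (1 + s * x)\<^sup>2"

definition gmeas :: "real \<Rightarrow> real measure" where
  "gmeas s = density lborel (\<lambda>x. ennreal (gdens s x) * indicator {0<..<1} x)"

text \<open>The mass of \<open>(1 / (m + 1), 1 / m]\<close> under \<open>gmeas s\<close> for
  \<open>m \<ge> 1\<close>: \<open>gdens s\<close> has the antiderivative
  \<open>(1 + s) * x / (1 + s * x)\<close>, and its difference between the two ends simplifies to
  this.\<close>

definition digit_prob :: "real \<Rightarrow> nat \<Rightarrow> real" where
  "digit_prob s m = (1 + s) / ((real m + s) * (real m + s + 1))"

text \<open>Digits are indexed from \<open>0\<close> here.\<close>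
definition digit :: "nat \<Rightarrow> real \<Rightarrow> nat" where
  "digit k x = cf_digit (Suc k) x"

lemma digit_Suc: "digit (Suc k) x = digit k (gauss_map x)"
  by (simp add: digit_def cf_digit_def funpow_swap1)

lemma gdens_measurable [measurable]: "gdens s \<in> borel_measurable borel"
  unfolding gdens_def by measurable

lemma gauss_map_measurable [measurable]: "gauss_map \<in> borel_measurable borel"
  unfolding gauss_map_def frac_def by measurable

lemma gauss_map_funpow_measurable [measurable]: "(gauss_map ^^ n) \<in> borel_measurable borel"
  by (induction n) (simp_all add: comp_def)

lemma digit_measurable [measurable]: "digit k \<in> measurable borel (count_space UNIV)"
  unfolding digit_def cf_digit_def by measurable

lemma sets_gmeas [simp, measurable_cong]: "sets (gmeas s) = sets borel"
  by (simp add: gmeas_def)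

lemma space_gmeas [simp]: "space (gmeas s) = UNIV"
  by (simp add: gmeas_def)

lemma nn_integral_gmeas:
  assumes [measurable]: "F \<in> borel_measurable borel"
  shows "(\<integral>\<^sup>+x. F x \<partial>gmeas s) = (\<integral>\<^sup>+x. ennreal (gdens s x) * F x * indicator {0<..<1} x \<partial>lborel)"
  unfolding gmeas_def by (subst nn_integral_density) (auto simp: ac_simps)

lemma gmeas_prob: 
  assumes s: "0 \<le> s"
  shows "emeasure (gmeas s) UNIV = 1"
proof -
  have pos: "1 + s * x > 0" if "x \<in> {0..1}" for x
    using s that by (simp add: add_pos_nonneg)
  have "emeasure (gmeas s) UNIV = (\<integral>\<^sup>+x. ennreal (gdens s x) * indicator {0<..<1} x \<partial>lborel)"
    using nn_integral_gmeas[of "\<lambda>_. 1" s] by simp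
  also have "\<dots> = (\<integral>\<^sup>+x. ennreal (gdens s x) * indicator {0..1} x \<partial>lborel)"
    by (rule nn_integral_cong_AE)
      (use AE_lborel_singleton[of 0] AE_lborel_singleton[of 1] in eventually_elim, auto split: split_indicator)
  also have "\<dots> = ennreal ((1 + s) * 1 / (1 + s * 1) - (1 + s) * 0 / (1 + s * 0))"
  proof (rule nn_integral_FTC_Icc)
    fix x :: real assume x: "x \<in> {0..1}"
    show "((\<lambda>x. (1 + s) * x / (1 + s * x)) has_real_derivative gdens s x) (at x)"
      using pos[OF x] unfolding gdens_def
      by (auto intro!: derivative_eq_intros simp: power2_eq_square) (simp add: field_simps)
  qed (use s in \<open>auto simp: gdens_def\<close>)
  finally show ?thesis using s by simp
qed

lemma gdens_bounds:
  assumes "s \<in> {0..1}" "x \<in> {0..1}"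
  shows "1 / 2 \<le> gdens s x" "gdens s x \<le> 2"
proof -
  have sx: "0 \<le> s * x" "s * x \<le> s" using assms by (auto simp: mult_left_le)
  have "(1 + s * x)\<^sup>2 \<le> (1 + s)\<^sup>2" using sx by (intro power_mono) auto
  also have "\<dots> \<le> 2 * (1 + s)"
    unfolding power2_eq_square using assms by (intro mult_right_mono) auto
  finally show "1 / 2 \<le> gdens s x" using sx unfolding gdens_def by (subst le_divide_eq) auto
  have "1 + s \<le> 2 * 1" using assms by simp
  also have "\<dots> \<le> 2 * (1 + s * x)\<^sup>2" using sx by (intro mult_left_mono) (auto intro: one_le_power)
  finally show "gdens s x \<le> 2" using sx unfolding gdens_def by (subst divide_le_eq) auto
qed

text \<open>All the densities lie between 1/2 and 2, so forgetting the past, that is replacing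
  \<open>s\<close> by 0, costs at most a factor 2.\<close>

lemma nn_integral_gmeas_compare:
  assumes [measurable]: "F \<in> borel_measurable borel" and s: "s \<in> {0..1}"
  shows "(\<integral>\<^sup>+x. F x \<partial>gmeas s) \<le> 2 * (\<integral>\<^sup>+x. F x \<partial>gmeas 0)"
    and "(\<integral>\<^sup>+x. F x \<partial>gmeas 0) \<le> 2 * (\<integral>\<^sup>+x. F x \<partial>gmeas s)"
proof -
  have 1: "gdens 0 x = 1" for x by (simp add: gdens_def)
  have "(\<integral>\<^sup>+x. F x \<partial>gmeas s) \<le> (\<integral>\<^sup>+x. 2 * (ennreal (gdens 0 x) * F x * indicator {0<..<1} x) \<partial>lborel)"
    unfolding nn_integral_gmeas[OF assms(1)] 1
  proof (intro nn_integral_mono)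
    fix x :: real
    have "ennreal (gdens s x) \<le> 2" if "x \<in> {0<..<1}"
      using gdens_bounds(2)[of s x] s that ennreal_leI[of "gdens s x" 2] by simp
    then show "ennreal (gdens s x) * F x * indicator {0<..<1} x \<le> 2 * (ennreal 1 * F x * indicator {0<..<1} x)"
      by (auto split: split_indicator intro: mult_right_mono)
  qed
  also have "\<dots> = 2 * (\<integral>\<^sup>+x. F x \<partial>gmeas 0)"
    by (subst nn_integral_cmult) (auto simp: nn_integral_gmeas)
  finally show "(\<integral>\<^sup>+x. F x \<partial>gmeas s) \<le> 2 * (\<integral>\<^sup>+x. F x \<partial>gmeas 0)" .
  have "(\<integral>\<^sup>+x. F x \<partial>gmeas 0) \<le> (\<integral>\<^sup>+x. 2 * (ennreal (gdens s x) * F x * indicator {0<..<1} x) \<partial>lborel)"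
    unfolding nn_integral_gmeas[OF assms(1)] 1
  proof (intro nn_integral_mono)
    fix x :: real
    have "1 \<le> 2 * ennreal (gdens s x)" if "x \<in> {0<..<1}"
    proof -
      have "ennreal 1 \<le> ennreal (2 * gdens s x)"
        using gdens_bounds(1)[of s x] s that by (intro ennreal_leI) auto
      also have "\<dots> = 2 * ennreal (gdens s x)"
        using gdens_bounds(1)[of s x] s that by (subst ennreal_mult) auto
      finally show ?thesis by simp
    qed
    then have "1 * F x \<le> 2 * ennreal (gdens s x) * F x" if "x \<in> {0<..<1}"
      using that by (intro mult_right_mono) auto
    then show "ennreal 1 * F x * indicator {0<..<1} x \<le> 2 * (ennreal (gdens s x) * F x * indicator {0<..<1} x)"
      by (auto split: split_indicator simp: ac_simps)
  qed
  also have "\<dots> = 2 * (\<integral>\<^sup>+x. F x \<partial>gmeas s)"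
    by (subst nn_integral_cmult) (auto simp: nn_integral_gmeas)
  finally show "(\<integral>\<^sup>+x. F x \<partial>gmeas 0) \<le> 2 * (\<integral>\<^sup>+x. F x \<partial>gmeas s)" .
qed

section \<open>Inverse branches of the Gauss map and the Markov property\<close>

lemma nn_integral_gauss_branch:
  fixes f :: "real \<Rightarrow> ennreal" and m :: nat
  assumes [measurable]: "f \<in> borel_measurable borel" and m: "m \<ge> 1"
  shows "(\<integral>\<^sup>+x. f x * indicator {1 / (real m + 1)<..1 / real m} x \<partial>lborel)
    = (\<integral>\<^sup>+y. f (1 / (real m + y)) * ennreal (1 / (real m + y)\<^sup>2) * indicator {0<..<1} y \<partial>lborel)"
proof -
  \<comment> \<open>The substitution rule asks for a nonnegative derivative, so the decreasing
    branch is first parametrised by \<open>z = 1 - y\<close>; the reflection back to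
    \<open>y\<close> is a separate affine change of variable.\<close>
  define g where "g = (\<lambda>z. 1 / (real m + 1 - z))"
  have "(\<integral>\<^sup>+x. f x * indicator {1 / (real m + 1)<..1 / real m} x \<partial>lborel)
      = (\<integral>\<^sup>+x. f x * indicator {g 0..g 1} x \<partial>lborel)"
    by (rule nn_integral_cong_AE)
      (use AE_lborel_singleton[of "g 0"] in eventually_elim, auto split: split_indicator simp: g_def)
  also have "\<dots> = (\<integral>\<^sup>+z. f (g z) * ennreal (1 / (real m + 1 - z)\<^sup>2) * indicator {0..1} z \<partial>lborel)"
  proof (rule nn_integral_substitution_aux)
    fix z :: real assume z: "z \<in> {0..1}"
    then have nz: "real m + 1 - z \<noteq> 0" using m by auto
    then show "(g has_real_derivative 1 / (real m + 1 - z)\<^sup>2) (at z)"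
      unfolding g_def by (auto intro!: derivative_eq_intros simp: power2_eq_square)
  next
    show "continuous_on {0..1} (\<lambda>z. 1 / (real m + 1 - z)\<^sup>2)"
      using m by (intro continuous_intros) auto
  qed auto
  also have "\<dots> = (\<integral>\<^sup>+y. f (g (1 + (-1) * y)) * ennreal (1 / (real m + 1 - (1 + (-1) * y))\<^sup>2)
       * indicator {0..1} (1 + (-1) * y) \<partial>lborel)"
    by (subst nn_integral_real_affine[where c="-1" and t=1]) (auto simp: g_def)
  also have "\<dots> = (\<integral>\<^sup>+y. f (1 / (real m + y)) * ennreal (1 / (real m + y)\<^sup>2) * indicator {0<..<1} y \<partial>lborel)"
    by (rule nn_integral_cong_AE)
      (use AE_lborel_singleton[of 0] AE_lborel_singleton[of 1] in eventually_elim,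
        auto split: split_indicator simp: g_def)
  finally show ?thesis .
qed

text \<open>The family of densities is closed under the inverse branches: pulled back with its
  Jacobian, \<open>gdens s\<close> is a constant times another member. Hence the single number
  \<open>s\<close> records all that matters about the past.\<close>

lemma gdens_gauss_branch:
  assumes s: "0 \<le> s" and y: "0 < y" and m: "m \<ge> 1"
  shows "gdens s (1 / (real m + y)) * (1 / (real m + y)\<^sup>2) = digit_prob s m * gdens (1 / (real m + s)) y"
proof -
  have p: "real m + y > 0" "real m + s > 0" "real m + s + y > 0" "real m + s + 1 > 0" using assms by auto
  have a: "1 + s * (1 / (real m + y)) = (real m + s + y) / (real m + y)" using p by (simp add: field_simps)
  have b: "1 + 1 / (real m + s) * y = (real m + s + y) / (real m + s)"
    "1 + 1 / (real m + s) = (real m + s + 1) / (real m + s)" using p by (simp_all add: field_simps)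
  \<comment> \<open>Here \<open>Y = m + y\<close>, \<open>M = m + s\<close>,
    \<open>Z = m + s + y\<close>, \<open>W = m + s + 1\<close>; both sides reduce to
    \<open>c / Z\<^sup>2\<close>.\<close>
  have "c / (Z / Y)\<^sup>2 * (1 / Y\<^sup>2) = c / (M * W) * ((W / M) / (Z / M)\<^sup>2)"
    if "Y > 0" "M > 0" "Z > 0" "W > 0" for c Y M Z W :: real
    using that by (simp add: field_simps power2_eq_square)
  from this[OF p] show ?thesis unfolding gdens_def digit_prob_def a b .
qed

theorem nn_integral_gmeas_unfold:
  assumes [measurable]: "F \<in> borel_measurable borel" and s: "0 \<le> s"
  shows "(\<integral>\<^sup>+x. F x \<partial>gmeas s) = (\<Sum>m. ennreal (digit_prob s (Suc m)) *
     (\<integral>\<^sup>+y. F (1 / (real (Suc m) + y)) \<partial>gmeas (1 / (real (Suc m) + s))))"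
proof -
  define A where "A = (\<lambda>m. {1 / (real (Suc m) + 1)<..1 / real (Suc m)})"
  have Aiff: "x \<in> A m \<longleftrightarrow> 0 < x \<and> x \<le> 1 \<and> \<lfloor>1 / x\<rfloor> = int (Suc m)" for x m
  proof -
    have "x \<in> A m \<longleftrightarrow> 0 < x \<and> real (Suc m) \<le> 1 / x \<and> 1 / x < real (Suc m) + 1"
    proof (cases "0 < x")
      case True then show ?thesis by (auto simp: A_def field_simps)
    next
      case False
      have "0 < 1 / (real (Suc m) + 1)" by simp
      then show ?thesis using False unfolding A_def
        by (metis greaterThanAtMost_iff order.strict_trans)
    qed
    also have "\<dots> \<longleftrightarrow> 0 < x \<and> \<lfloor>1 / x\<rfloor> = int (Suc m)" by (auto simp: floor_eq_iff)
    also have "\<dots> \<longleftrightarrow> 0 < x \<and> x \<le> 1 \<and> \<lfloor>1 / x\<rfloor> = int (Suc m)"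
    proof -
      have "x \<le> 1" if "0 < x" "\<lfloor>1 / x\<rfloor> = int (Suc m)"
      proof -
        have "1 \<le> \<lfloor>1 / x\<rfloor>" using that by simp
        then have "1 \<le> 1 / x" by linarith
        then show ?thesis using that by (simp add: field_simps)
      qed
      then show ?thesis by blast
    qed
    finally show ?thesis .
  qed
  have disj: "disjoint_family A" unfolding disjoint_family_on_def by (auto simp: Aiff)
  have "(\<Union>m. A m) = {0<..1}"
  proof -
    have "\<exists>m. \<lfloor>1 / x\<rfloor> = int (Suc m)" if "0 < x" "x \<le> 1" for x :: real
    proof -
      have "\<lfloor>1 / x\<rfloor> \<ge> 1" using that by (simp add: le_floor_iff)
      then have "\<lfloor>1 / x\<rfloor> = int (Suc (nat (\<lfloor>1 / x\<rfloor> - 1)))" by simp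
      then show ?thesis by blast
    qed
    then show ?thesis using Aiff by auto
  qed
  then have ind: "(\<Sum>m. indicator (A m) x) = (indicator {0<..1} x :: ennreal)" for x
    using suminf_indicator[OF disj, of x] by simp
  have [measurable]: "A m \<in> sets borel" for m by (simp add: A_def)
  \<comment> \<open>The endpoint 1, a null set, is added so that the cylinders \<open>A m\<close>
    fill the interval exactly.\<close>
  have "(\<integral>\<^sup>+x. F x \<partial>gmeas s) = (\<integral>\<^sup>+x. ennreal (gdens s x) * F x * indicator {0<..1} x \<partial>lborel)"
    unfolding nn_integral_gmeas[OF assms(1)]
    by (rule nn_integral_cong_AE)
      (use AE_lborel_singleton[of 1] in eventually_elim, auto split: split_indicator)
  also have "\<dots> = (\<integral>\<^sup>+x. (\<Sum>m. ennreal (gdens s x) * F x * indicator (A m) x) \<partial>lborel)"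
    unfolding ind[symmetric] by simp
  also have "\<dots> = (\<Sum>m. \<integral>\<^sup>+x. (ennreal (gdens s x) * F x) * indicator (A m) x \<partial>lborel)"
    by (rule nn_integral_suminf) measurable
  also have "\<dots> = (\<Sum>m. ennreal (digit_prob s (Suc m)) *
     (\<integral>\<^sup>+y. F (1 / (real (Suc m) + y)) \<partial>gmeas (1 / (real (Suc m) + s))))"
  proof (rule suminf_cong)
    fix m
    let ?s = "1 / (real (Suc m) + s)"
    have "(\<integral>\<^sup>+x. (ennreal (gdens s x) * F x) * indicator (A m) x \<partial>lborel)
       = (\<integral>\<^sup>+y. ennreal (gdens s (1 / (real (Suc m) + y))) * F (1 / (real (Suc m) + y))
            * ennreal (1 / (real (Suc m) + y)\<^sup>2) * indicator {0<..<1} y \<partial>lborel)"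
      unfolding A_def by (subst nn_integral_gauss_branch) auto
    also have "\<dots> = (\<integral>\<^sup>+y. ennreal (digit_prob s (Suc m)) *
        (ennreal (gdens ?s y) * F (1 / (real (Suc m) + y)) * indicator {0<..<1} y) \<partial>lborel)"
    proof (rule nn_integral_cong)
      fix y :: real
      show "ennreal (gdens s (1 / (real (Suc m) + y))) * F (1 / (real (Suc m) + y))
            * ennreal (1 / (real (Suc m) + y)\<^sup>2) * indicator {0<..<1} y
        = ennreal (digit_prob s (Suc m)) *
        (ennreal (gdens ?s y) * F (1 / (real (Suc m) + y)) * indicator {0<..<1} y)"
      proof (cases "y \<in> {0<..<1}")
        case True
        have "ennreal (gdens s (1 / (real (Suc m) + y))) * ennreal (1 / (real (Suc m) + y)\<^sup>2)
          = ennreal (gdens s (1 / (real (Suc m) + y)) * (1 / (real (Suc m) + y)\<^sup>2))"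
          using s by (subst ennreal_mult'') auto
        also have "\<dots> = ennreal (digit_prob s (Suc m) * gdens ?s y)"
          using gdens_gauss_branch[of s y "Suc m"] s True by simp
        also have "\<dots> = ennreal (digit_prob s (Suc m)) * ennreal (gdens ?s y)"
          using s by (subst ennreal_mult'') (auto simp: gdens_def)
        finally show ?thesis by (simp add: mult_ac)
      qed auto
    qed
    also have "\<dots> = ennreal (digit_prob s (Suc m)) * (\<integral>\<^sup>+y. F (1 / (real (Suc m) + y)) \<partial>gmeas ?s)"
      by (subst nn_integral_cmult) (auto simp: nn_integral_gmeas)
    finally show "(\<integral>\<^sup>+x. (ennreal (gdens s x) * F x) * indicator (A m) x \<partial>lborel)
      = ennreal (digit_prob s (Suc m)) * (\<integral>\<^sup>+y. F (1 / (real (Suc m) + y)) \<partial>gmeas ?s)" .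
  qed
  finally show ?thesis .
qed

lemma gauss_branch_eq:
  assumes "y \<in> {0<..<1}" "m \<ge> 1"
  shows "gauss_map (1 / (real m + y)) = y" "digit 0 (1 / (real m + y)) = m"
  using assms by (auto simp: gauss_map_def digit_def cf_digit_def frac_def floor_eq_iff nat_eq_iff
     intro: floor_unique)

text \<open>The Markov property: given that the first digit is \<open>m\<close>, the image under
  \<open>gauss_map\<close> has law \<open>gmeas (1 / (m + s))\<close>. The inductions over digits
  peel off the first digit by this identity.\<close>

theorem nn_integral_gmeas_digit:
  assumes [measurable]: "X \<in> borel_measurable borel" and s: "0 \<le> s"
  shows "(\<integral>\<^sup>+x. h (digit 0 x) * X (gauss_map x) \<partial>gmeas s) = (\<Sum>m. ennreal (digit_prob s (Suc m)) *
     (h (Suc m) * (\<integral>\<^sup>+y. X y \<partial>gmeas (1 / (real (Suc m) + s)))))"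
proof -
  have "(\<integral>\<^sup>+x. h (digit 0 x) * X (gauss_map x) \<partial>gmeas s) = (\<Sum>m. ennreal (digit_prob s (Suc m)) *
     (\<integral>\<^sup>+y. h (digit 0 (1 / (real (Suc m) + y))) * X (gauss_map (1 / (real (Suc m) + y))) \<partial>gmeas (1 / (real (Suc m) + s))))"
    using s by (subst nn_integral_gmeas_unfold) measurable
  also have "\<dots> = (\<Sum>m. ennreal (digit_prob s (Suc m)) *
     (h (Suc m) * (\<integral>\<^sup>+y. X y \<partial>gmeas (1 / (real (Suc m) + s)))))"
  proof (rule suminf_cong)
    fix m
    have "(\<integral>\<^sup>+y. h (digit 0 (1 / (real (Suc m) + y))) * X (gauss_map (1 / (real (Suc m) + y))) \<partial>gmeas (1 / (real (Suc m) + s)))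
       = (\<integral>\<^sup>+y. h (Suc m) * X y \<partial>gmeas (1 / (real (Suc m) + s)))"
      by (subst (1 2) nn_integral_gmeas; measurable?; intro nn_integral_cong)
        (simp add: gauss_branch_eq del: of_nat_Suc split: split_indicator)
    also have "\<dots> = h (Suc m) * (\<integral>\<^sup>+y. X y \<partial>gmeas (1 / (real (Suc m) + s)))"
      by (rule nn_integral_cmult) measurable
    finally show "ennreal (digit_prob s (Suc m)) *
     (\<integral>\<^sup>+y. h (digit 0 (1 / (real (Suc m) + y))) * X (gauss_map (1 / (real (Suc m) + y))) \<partial>gmeas (1 / (real (Suc m) + s)))
     = ennreal (digit_prob s (Suc m)) *
     (h (Suc m) * (\<integral>\<^sup>+y. X y \<partial>gmeas (1 / (real (Suc m) + s))))" by simp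
  qed
  finally show ?thesis .
qed

lemma digit_prob_bounds:
  assumes s: "s \<in> {0..1}" and m: "m \<ge> 1"
  shows "1 / (3 * (real m)\<^sup>2) \<le> digit_prob s m" "digit_prob s m \<le> 2 / (real m)\<^sup>2"
proof -
  have m1: "real m \<ge> 1" using m by simp
  have "(real m)\<^sup>2 \<le> (real m + s) * (real m + s + 1)"
    unfolding power2_eq_square using s m1 by (intro mult_mono) auto
  then show "digit_prob s m \<le> 2 / (real m)\<^sup>2"
    unfolding digit_prob_def using s m1 by (intro frac_le) auto
  have "s \<le> s * real m" using s m1 by (simp add: mult_le_cancel_left1)
  then have "(real m + s) * (real m + s + 1) \<le> (real m * (1 + s)) * (3 * real m)"
    using s m1 by (intro mult_mono) (auto simp: algebra_simps)
  also have "\<dots> = (1 + s) * (3 * (real m)\<^sup>2)" by (simp add: power2_eq_square)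
  finally have le: "(real m + s) * (real m + s + 1) \<le> (1 + s) * (3 * (real m)\<^sup>2)" .
  have "1 * ((real m + s) * (real m + s + 1)) \<le> (1 + s) * (3 * (real m)\<^sup>2)" using le by simp
  then show "1 / (3 * (real m)\<^sup>2) \<le> digit_prob s m"
    unfolding digit_prob_def using s m1 by (subst frac_le_eq) (auto simp: divide_le_0_iff)
qed

section \<open>Estimates replacing independence\<close>

lemma gauss_parameter: "s \<in> {0..1} \<Longrightarrow> 1 / (real (Suc m) + s) \<in> {0..1}"
  by (auto simp: divide_le_eq)

lemma digit_comp_measurable [measurable]:
  "(\<lambda>x. h (digit k x)) \<in> borel_measurable borel" for h :: "nat \<Rightarrow> 'b::topological_space"
  by (rule measurable_compose[OF digit_measurable]) simp

lemma prod_digit_measurable [measurable]: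
  "(\<lambda>x. \<Prod>k\<in>A. h k (digit (l k) x)) \<in> borel_measurable borel" for h :: "nat \<Rightarrow> nat \<Rightarrow> ennreal"
  by (rule borel_measurable_prod_ennreal) measurable

lemma nn_integral_first_digit:
  assumes s: "0 \<le> s"
  shows "(\<integral>\<^sup>+x. h (digit 0 x) \<partial>gmeas s) = (\<Sum>m. ennreal (digit_prob s (Suc m)) * h (Suc m))"
proof -
  have "(\<integral>\<^sup>+x. h (digit 0 x) * 1 \<partial>gmeas s) = (\<Sum>m. ennreal (digit_prob s (Suc m)) * (h (Suc m) *
      (\<integral>\<^sup>+y. 1 \<partial>gmeas (1 / (real (Suc m) + s)))))"
    by (rule nn_integral_gmeas_digit) (use s in auto)
  moreover have "(\<integral>\<^sup>+y. 1 \<partial>gmeas (1 / (real (Suc m) + s))) = 1" for m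
    using s gmeas_prob[of "1 / (real (Suc m) + s)"] by simp
  ultimately show ?thesis by (simp only: mult_1_right)
qed

lemma nn_integral_first_digit_upper:
  assumes s: "s \<in> {0..1}"
  shows "(\<integral>\<^sup>+x. h (digit 0 x) \<partial>gmeas s) \<le> 2 * (\<Sum>m. h (Suc m) * ennreal (1 / (real (Suc m))\<^sup>2))"
proof -
  have "(\<Sum>m. ennreal (digit_prob s (Suc m)) * h (Suc m)) \<le> (\<Sum>m. 2 * (h (Suc m) * ennreal (1 / (real (Suc m))\<^sup>2)))"
  proof (intro suminf_le summableI)
    fix m
    have "ennreal (digit_prob s (Suc m)) \<le> ennreal (2 * (1 / (real (Suc m))\<^sup>2))"
      using digit_prob_bounds(2)[OF s, of "Suc m"] by (intro ennreal_leI) auto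
    also have "\<dots> = 2 * ennreal (1 / (real (Suc m))\<^sup>2)" by (subst ennreal_mult) auto
    finally have "ennreal (digit_prob s (Suc m)) * h (Suc m) \<le> 2 * ennreal (1 / (real (Suc m))\<^sup>2) * h (Suc m)"
      by (rule mult_right_mono) simp
    then show "ennreal (digit_prob s (Suc m)) * h (Suc m) \<le> 2 * (h (Suc m) * ennreal (1 / (real (Suc m))\<^sup>2))"
      by (simp only: mult_ac)
  qed
  then show ?thesis using s by (simp add: nn_integral_first_digit)
qed

lemma prod_digit_Suc:
  "(\<Prod>k<Suc n. h k (digit k x)) = h 0 (digit 0 x) * (\<Prod>k<n. h (Suc k) (digit k (gauss_map x)))"
  by (subst prod.lessThan_Suc_shift) (simp add: digit_Suc)

text \<open>One-digit bounds that are uniform in \<open>s\<close> multiply along the sequence, as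
  they would under independence. The induction must vary \<open>s\<close>, because each digit read
  changes the parameter.\<close>

lemma nn_integral_prod_digits_le:
  fixes h :: "nat \<Rightarrow> nat \<Rightarrow> ennreal"
  assumes "\<And>k s. k < n \<Longrightarrow> s \<in> {0..1} \<Longrightarrow> (\<integral>\<^sup>+x. h k (digit 0 x) \<partial>gmeas s) \<le> c k" and "s \<in> {0..1}"
  shows "(\<integral>\<^sup>+x. (\<Prod>k<n. h k (digit k x)) \<partial>gmeas s) \<le> (\<Prod>k<n. c k)"
  using assms
proof (induction n arbitrary: h c s)
  case 0
  then show ?case using gmeas_prob[of s] by simp
next
  case (Suc n)
  have s: "0 \<le> s" using Suc.prems by simp
  have "(\<integral>\<^sup>+x. (\<Prod>k<Suc n. h k (digit k x)) \<partial>gmeas s)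
      = (\<Sum>m. ennreal (digit_prob s (Suc m)) * (h 0 (Suc m) *
          (\<integral>\<^sup>+y. (\<Prod>k<n. h (Suc k) (digit k y)) \<partial>gmeas (1 / (real (Suc m) + s)))))"
    unfolding prod_digit_Suc by (rule nn_integral_gmeas_digit) (use s in auto)
  also have "\<dots> \<le> (\<Sum>m. ennreal (digit_prob s (Suc m)) * (h 0 (Suc m) * (\<Prod>k<n. c (Suc k))))"
    using Suc.prems gauss_parameter[OF Suc.prems(2)]
    by (intro suminf_le summableI mult_left_mono Suc.IH) auto
  also have "\<dots> = (\<integral>\<^sup>+x. h 0 (digit 0 x) \<partial>gmeas s) * (\<Prod>k<n. c (Suc k))"
    using s by (simp add: nn_integral_first_digit mult.assoc[symmetric] ennreal_suminf_multc)
  also have "\<dots> \<le> c 0 * (\<Prod>k<n. c (Suc k))"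
    using Suc.prems by (intro mult_right_mono) auto
  also have "\<dots> = (\<Prod>k<Suc n. c k)" by (subst prod.lessThan_Suc_shift) simp
  finally show ?case .
qed

text \<open>The weights \<open>r k\<close> may be arbitrarily small; since digit \<open>1\<close> is admissible at place \<open>j\<close> and has
  probability bounded below, integrating out the \<open>j\<close>-th digit costs a bounded factor only.\<close>
lemma nn_integral_digit_mult_prod_le:
  fixes f :: "nat \<Rightarrow> ennreal" and r :: "nat \<Rightarrow> nat \<Rightarrow> ennreal"
  assumes "j < n" "r j 1 = 1" "\<And>m. r j m \<le> 1" "s \<in> {0..1}"
  shows "(\<integral>\<^sup>+x. f (digit j x) * (\<Prod>k<n. r k (digit k x)) \<partial>gmeas s)
    \<le> 24 * (\<Sum>m. f (Suc m) * ennreal (1 / (real (Suc m))\<^sup>2)) * (\<integral>\<^sup>+x. (\<Prod>k<n. r k (digit k x)) \<partial>gmeas s)"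
  using assms
proof (induction j arbitrary: n r s)
  case 0
  then obtain n' where n: "n = Suc n'" by (cases n) auto
  have s: "0 \<le> s" using 0 by simp
  define X where "X = (\<lambda>y. \<Prod>k<n'. r (Suc k) (digit k y))"
  have [measurable]: "X \<in> borel_measurable borel" unfolding X_def by measurable
  define F where "F = (\<Sum>m. f (Suc m) * ennreal (1 / (real (Suc m))\<^sup>2))"
  define E where "E = (\<lambda>s. \<integral>\<^sup>+y. X y \<partial>gmeas s)"
  have P: "(\<Prod>k<n. r k (digit k x)) = r 0 (digit 0 x) * X (gauss_map x)" for x
    unfolding n prod_digit_Suc X_def ..
  have "(\<integral>\<^sup>+x. f (digit 0 x) * (\<Prod>k<n. r k (digit k x)) \<partial>gmeas s)
     = (\<integral>\<^sup>+x. (f (digit 0 x) * r 0 (digit 0 x)) * X (gauss_map x) \<partial>gmeas s)"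
    unfolding P by (simp add: mult.assoc)
  also have "\<dots> = (\<Sum>m. ennreal (digit_prob s (Suc m)) * (f (Suc m) * r 0 (Suc m) * E (1 / (real (Suc m) + s))))"
    unfolding E_def by (rule nn_integral_gmeas_digit[where h="\<lambda>m. f m * r 0 m"]) (use s in auto)
  \<comment> \<open>Replacing \<open>E (1 / (m + s))\<close> by \<open>2 * E 0\<close> decouples the
    remaining digits from \<open>m\<close>, so that the sum over \<open>m\<close> factors.\<close>
  also have "\<dots> \<le> (\<Sum>m. ennreal (digit_prob s (Suc m)) * (f (Suc m) * (2 * E 0)))"
  proof (intro suminf_le summableI mult_left_mono)
    fix m
    have "f (Suc m) * r 0 (Suc m) \<le> f (Suc m) * 1" using 0 by (intro mult_left_mono) auto
    moreover have "E (1 / (real (Suc m) + s)) \<le> 2 * E 0"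
      unfolding E_def by (rule nn_integral_gmeas_compare) (use gauss_parameter[OF 0(4)] in auto)
    ultimately show "f (Suc m) * r 0 (Suc m) * E (1 / (real (Suc m) + s)) \<le> f (Suc m) * (2 * E 0)"
      by (intro mult_mono) auto
  qed auto
  also have "\<dots> = (\<integral>\<^sup>+x. f (digit 0 x) \<partial>gmeas s) * (2 * E 0)"
    using s by (simp add: nn_integral_first_digit mult.assoc[symmetric] ennreal_suminf_multc)
  also have "\<dots> \<le> (2 * F) * (2 * E 0)"
    unfolding F_def by (intro mult_right_mono nn_integral_first_digit_upper 0) auto
  also have "E 0 \<le> 6 * (\<integral>\<^sup>+x. (\<Prod>k<n. r k (digit k x)) \<partial>gmeas s)"
  proof -
    have "E 0 \<le> 2 * E (1 / (real (Suc 0) + s))"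
      unfolding E_def by (rule nn_integral_gmeas_compare) (measurable, rule gauss_parameter[OF 0(4)])
    also have "\<dots> = 6 * (ennreal (1 / 3) * (r 0 (Suc 0) * E (1 / (real (Suc 0) + s))))"
    proof -
      have "6 * ennreal (1/3) = ennreal (6 * (1/3))" by (subst ennreal_mult) auto
      then have "6 * ennreal (1/3) = 2" by simp
      then show ?thesis using 0(2) by (simp add: mult.assoc[symmetric])
    qed
    also have "\<dots> \<le> 6 * (ennreal (digit_prob s (Suc 0)) * (r 0 (Suc 0) * E (1 / (real (Suc 0) + s))))"
      using digit_prob_bounds(1)[OF 0(4), of "Suc 0"]
      by (intro mult_left_mono mult_right_mono ennreal_leI) auto
    also have "\<dots> \<le> 6 * (\<Sum>m. ennreal (digit_prob s (Suc m)) * (r 0 (Suc m) * E (1 / (real (Suc m) + s))))"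
      using sum_le_suminf[of "\<lambda>m. ennreal (digit_prob s (Suc m)) * (r 0 (Suc m) * E (1 / (real (Suc m) + s)))" "{0}"]
      by (intro mult_left_mono) (auto simp: summableI)
    also have "\<dots> = 6 * (\<integral>\<^sup>+x. (\<Prod>k<n. r k (digit k x)) \<partial>gmeas s)"
      unfolding P E_def by (subst nn_integral_gmeas_digit[symmetric, where h="r 0"]) (use s in auto)
    finally show ?thesis .
  qed
  then have "(2 * F) * (2 * E 0) \<le> (2 * F) * (2 * (6 * (\<integral>\<^sup>+x. (\<Prod>k<n. r k (digit k x)) \<partial>gmeas s)))"
    by (intro mult_left_mono) auto
  also have "\<dots> = (2 * 2 * 6) * F * (\<integral>\<^sup>+x. (\<Prod>k<n. r k (digit k x)) \<partial>gmeas s)"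
    by (simp only: mult_ac)
  also have "(2 * 2 * 6 :: ennreal) = 24" by simp
  finally show ?case unfolding F_def .
next
  case (Suc j)
  then obtain n' where n: "n = Suc n'" by (cases n) auto
  have s: "0 \<le> s" using Suc by simp
  define F where "F = (\<Sum>m. f (Suc m) * ennreal (1 / (real (Suc m))\<^sup>2))"
  define X where "X = (\<lambda>y. \<Prod>k<n'. r (Suc k) (digit k y))"
  have [measurable]: "X \<in> borel_measurable borel" unfolding X_def by measurable
  have P: "(\<Prod>k<n. r k (digit k x)) = r 0 (digit 0 x) * X (gauss_map x)" for x
    unfolding n prod_digit_Suc X_def ..
  have "(\<integral>\<^sup>+x. f (digit (Suc j) x) * (\<Prod>k<n. r k (digit k x)) \<partial>gmeas s)
     = (\<integral>\<^sup>+x. r 0 (digit 0 x) * (f (digit j (gauss_map x)) * X (gauss_map x)) \<partial>gmeas s)"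
    unfolding P digit_Suc by (simp add: mult_ac)
  also have "\<dots> = (\<Sum>m. ennreal (digit_prob s (Suc m)) * (r 0 (Suc m) *
      (\<integral>\<^sup>+y. f (digit j y) * X y \<partial>gmeas (1 / (real (Suc m) + s)))))"
    by (rule nn_integral_gmeas_digit[where X="\<lambda>y. f (digit j y) * X y"]) (use s in auto)
  also have "\<dots> \<le> (\<Sum>m. ennreal (digit_prob s (Suc m)) * (r 0 (Suc m) *
      (24 * F * (\<integral>\<^sup>+y. X y \<partial>gmeas (1 / (real (Suc m) + s))))))"
  proof (intro suminf_le summableI mult_left_mono)
    fix m
    show "(\<integral>\<^sup>+y. f (digit j y) * X y \<partial>gmeas (1 / (real (Suc m) + s)))
      \<le> 24 * F * (\<integral>\<^sup>+y. X y \<partial>gmeas (1 / (real (Suc m) + s)))"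
      unfolding F_def X_def
      by (rule Suc.IH[where r="\<lambda>k. r (Suc k)"]) (use Suc.prems n gauss_parameter[OF Suc.prems(4)] in auto)
  qed auto
  also have "\<dots> = 24 * F * (\<Sum>m. ennreal (digit_prob s (Suc m)) * (r 0 (Suc m) *
      (\<integral>\<^sup>+y. X y \<partial>gmeas (1 / (real (Suc m) + s)))))"
    by (subst ennreal_suminf_cmult[symmetric]) (simp only: mult_ac)
  also have "\<dots> = 24 * F * (\<integral>\<^sup>+x. (\<Prod>k<n. r k (digit k x)) \<partial>gmeas s)"
    unfolding P by (subst nn_integral_gmeas_digit[symmetric, where h="r 0"]) (use s in auto)
  finally show ?case unfolding F_def .
qed

section \<open>Almost sure lower bound for digit sums\<close>

definition digit_sum :: "nat \<Rightarrow> real \<Rightarrow> real" where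
  "digit_sum i x = (\<Sum>k<i. real (digit k x))"

definition nlog :: "nat \<Rightarrow> real" where
  "nlog i = (real i + 1) * ln (real i + 1)"

lemma digit_sum_measurable [measurable]: "digit_sum i \<in> borel_measurable borel"
  unfolding digit_sum_def by measurable

text \<open>Since \<open>exp (- u) \<le> 1 - u / 2\<close> on [0,1], the Laplace transform falls
  short of 1 by at least the mean of \<open>g\<close>, half the digit over \<open>N\<close>, cut off
  above \<open>N\<close>. With digit probabilities at least \<open>1 / (3 * m\<^sup>2)\<close> this
  mean is at least \<open>harm N / (6 * N)\<close>.\<close>

lemma digit_laplace_step:
  assumes s: "s \<in> {0..1}" and N: "N \<ge> 1"
  shows "(\<integral>\<^sup>+x. ennreal (exp (- (real (digit 0 x) / real N))) \<partial>gmeas s) \<le> ennreal (1 - ln (real N) / (6 * real N))"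
proof -
  define e where "e = (\<lambda>m. exp (- (real m / real N)))"
  define g where "g = (\<lambda>m. if m \<le> N then real m / (2 * real N) else 0)"
  have le1: "e m + g m \<le> 1" for m
  proof (cases "m \<le> N")
    case True
    define u where "u = real m / real N"
    have u: "0 \<le> u" "u \<le> 1" using True N by (auto simp: u_def)
    have "exp (- u) \<le> 1 / (1 + u)"
      using u exp_ge_add_one_self[of u] by (simp add: exp_minus inverse_eq_divide frac_le)
    also have "\<dots> \<le> 1 - u / 2"
    proof -
      have "u * u \<le> u" using u by (simp add: mult_left_le)
      then have "1 \<le> (1 - u / 2) * (1 + u)" by (simp add: algebra_simps)
      then show ?thesis using u by (subst divide_le_eq) auto
    qed
    finally show ?thesis using True by (simp add: e_def g_def u_def)
  qed (simp add: e_def g_def)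
  have "(\<integral>\<^sup>+x. ennreal (e (digit 0 x)) \<partial>gmeas s) + (\<integral>\<^sup>+x. ennreal (g (digit 0 x)) \<partial>gmeas s)
     = (\<integral>\<^sup>+x. ennreal (e (digit 0 x)) + ennreal (g (digit 0 x)) \<partial>gmeas s)"
    by (rule nn_integral_add[symmetric]) auto
  also have "\<dots> \<le> (\<integral>\<^sup>+x. 1 \<partial>gmeas s)"
  proof (rule nn_integral_mono)
    fix x
    have "ennreal (e (digit 0 x)) + ennreal (g (digit 0 x)) = ennreal (e (digit 0 x) + g (digit 0 x))"
      by (subst ennreal_plus) (auto simp: e_def g_def)
    also have "\<dots> \<le> 1" using le1 by simp
    finally show "ennreal (e (digit 0 x)) + ennreal (g (digit 0 x)) \<le> 1" .
  qed
  also have "\<dots> = 1" using gmeas_prob[of s] s by simp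
  finally have sum1: "(\<integral>\<^sup>+x. ennreal (e (digit 0 x)) \<partial>gmeas s) + (\<integral>\<^sup>+x. ennreal (g (digit 0 x)) \<partial>gmeas s) \<le> 1" .
  have "ln (real N) / (6 * real N) \<le> harm N / (6 * real N)"
  proof -
    have "ln (real N) \<le> ln (real N + 1)" using N by simp
    also have "\<dots> \<le> harm N" by (rule ln_le_harm)
    finally show ?thesis by (rule divide_right_mono) simp
  qed
  also have "\<dots> = (\<Sum>m<N. 1 / (3 * (real (Suc m))\<^sup>2) * g (Suc m))"
  proof -
    have "harm N = (\<Sum>m<N. inverse (real (Suc m)))"
      unfolding harm_def by (simp add: sum.atLeast1_atMost_eq)
    moreover have "inverse (real (Suc m)) / (6 * real N) = 1 / (3 * (real (Suc m))\<^sup>2) * g (Suc m)"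
      if "m < N" for m
      using that by (simp add: g_def field_simps power2_eq_square del: of_nat_Suc)
    ultimately show ?thesis by (simp add: sum_divide_distrib)
  qed
  also have "\<dots> \<le> (\<Sum>m<N. digit_prob s (Suc m) * g (Suc m))"
    using digit_prob_bounds(1)[OF s, of "Suc _"]
    by (intro sum_mono mult_right_mono) (auto simp: g_def simp del: of_nat_Suc)
  finally have "ennreal (ln (real N) / (6 * real N)) \<le> ennreal (\<Sum>m<N. digit_prob s (Suc m) * g (Suc m))"
    by (rule ennreal_leI)
  also have "\<dots> = (\<Sum>m<N. ennreal (digit_prob s (Suc m)) * ennreal (g (Suc m)))"
  proof -
    have "0 \<le> digit_prob s (Suc m)" "0 \<le> g (Suc m)" for m
      using s by (auto simp: digit_prob_def g_def)
    then show ?thesis by (simp add: ennreal_mult sum_ennreal[symmetric] del: of_nat_Suc)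
  qed
  also have "\<dots> \<le> (\<Sum>m. ennreal (digit_prob s (Suc m)) * ennreal (g (Suc m)))"
    by (intro sum_le_suminf) (auto simp: summableI)
  also have "\<dots> = (\<integral>\<^sup>+x. ennreal (g (digit 0 x)) \<partial>gmeas s)"
    using s by (subst nn_integral_first_digit) auto
  finally have "(\<integral>\<^sup>+x. ennreal (e (digit 0 x)) \<partial>gmeas s) + ennreal (ln (real N) / (6 * real N)) \<le> 1"
    using sum1 by (meson add_left_mono order_trans)
  then have "(\<integral>\<^sup>+x. ennreal (e (digit 0 x)) \<partial>gmeas s) \<le> 1 - ennreal (ln (real N) / (6 * real N))"
    by (metis ennreal_add_diff_cancel_right ennreal_minus_mono ennreal_neq_top infinity_ennreal_def order_refl)
  also have "\<dots> = ennreal (1 - ln (real N) / (6 * real N))"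
    using N by (subst ennreal_1[symmetric], subst ennreal_minus) auto
  finally show ?thesis by (simp add: e_def)
qed

text \<open>Exponential Markov inequality at the parameter \<open>1 / N\<close>; the one-digit
  bounds multiply to \<open>q ^ i\<close>, and \<open>1 - u \<le> exp (- u)\<close> puts them into
  the exponent.\<close>

lemma emeasure_digit_sum_le:
  assumes N: "N \<ge> 1"
  shows "emeasure (gmeas 0) {x. digit_sum i x \<le> b} \<le> ennreal (exp (b / real N - real i * ln (real N) / (6 * real N)))"
proof -
  define q where "q = 1 - ln (real N) / (6 * real N)"
  have "ln (real N) \<le> real N" using ln_le_minus_one[of "real N"] N by linarith
  then have q0: "q \<ge> 0" using N unfolding q_def by (simp add: divide_le_eq)
  have "emeasure (gmeas 0) {x. digit_sum i x \<le> b} = (\<integral>\<^sup>+x. indicator {x. digit_sum i x \<le> b} x \<partial>gmeas 0)"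
    by (rule nn_integral_indicator[symmetric]) measurable
  also have "\<dots> \<le> (\<integral>\<^sup>+x. ennreal (exp (b / real N)) * (\<Prod>k<i. ennreal (exp (- (real (digit k x) / real N)))) \<partial>gmeas 0)"
  proof (rule nn_integral_mono)
    fix x
    have "(\<Prod>k<i. ennreal (exp (- (real (digit k x) / real N)))) = ennreal (exp (- (digit_sum i x / real N)))"
      by (simp add: prod_ennreal exp_sum[symmetric] digit_sum_def sum_negf sum_divide_distrib)
    then have "ennreal (exp (b / real N)) * (\<Prod>k<i. ennreal (exp (- (real (digit k x) / real N))))
       = ennreal (exp (b / real N - digit_sum i x / real N))"
      by (simp add: ennreal_mult[symmetric] exp_add[symmetric])
    moreover have "1 \<le> exp (b / real N - digit_sum i x / real N)" if "digit_sum i x \<le> b"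
      using that N by (simp add: divide_right_mono)
    ultimately show "indicator {x. digit_sum i x \<le> b} x
       \<le> ennreal (exp (b / real N)) * (\<Prod>k<i. ennreal (exp (- (real (digit k x) / real N))))"
      by (auto split: split_indicator)
  qed
  also have "\<dots> = ennreal (exp (b / real N)) * (\<integral>\<^sup>+x. (\<Prod>k<i. ennreal (exp (- (real (digit k x) / real N)))) \<partial>gmeas 0)"
    by (rule nn_integral_cmult) measurable
  also have "\<dots> \<le> ennreal (exp (b / real N)) * (\<Prod>k<i. ennreal q)"
    using N unfolding q_def
    by (intro mult_left_mono nn_integral_prod_digits_le[where h="\<lambda>_ m. ennreal (exp (- (real m / real N)))"]
         digit_laplace_step) auto
  also have "\<dots> = ennreal (exp (b / real N) * q ^ i)"
    using q0 by (simp add: ennreal_mult ennreal_power)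
  also have "\<dots> \<le> ennreal (exp (b / real N) * exp (- (real i * ln (real N) / (6 * real N))))"
  proof (intro ennreal_leI mult_left_mono)
    have "q \<le> exp (- (ln (real N) / (6 * real N)))"
      unfolding q_def using exp_ge_add_one_self[of "- (ln (real N) / (6 * real N))"] by simp
    then have "q ^ i \<le> exp (- (ln (real N) / (6 * real N))) ^ i" using q0 by (rule power_mono)
    also have "\<dots> = exp (- (real i * ln (real N) / (6 * real N)))"
      by (simp add: exp_of_nat_mult[symmetric])
    finally show "q ^ i \<le> exp (- (real i * ln (real N) / (6 * real N)))" .
  qed auto
  finally show ?thesis by (simp add: exp_add[symmetric])
qed

text \<open>Chernoff bound with parameter \<open>1 / N\<close>, where \<open>N\<close> is about \<open>sqrt i\<close>.\<close>
lemma AE_digit_sum_lower: "AE x in gmeas 0. eventually (\<lambda>i. digit_sum i x > nlog i / 96) sequentially"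
proof -
  interpret finite_measure "gmeas 0"
    using gmeas_prob[of 0] by (intro finite_measureI) auto
  let ?A = "\<lambda>i. {x. digit_sum i x \<le> nlog i / 96}"
  \<comment> \<open>The constants fit as follows, with \<open>l = ln i\<close>:
    \<open>nlog i \<le> 4 * i * l\<close>, so the level costs at most
    \<open>i * l / (24 * N)\<close> in the exponent, while \<open>ln N \<ge> l / 2\<close> gains
    \<open>i * l / (12 * N)\<close>. The net gain is at least \<open>2 * l\<close> because
    \<open>N \<le> 2 * r\<close> and \<open>r \<ge> 96\<close>; hence
    \<open>9216 = 96\<^sup>2\<close>, and the bound is summable.\<close>
  have bound: "emeasure (gmeas 0) (?A i) \<le> ennreal (1 / (real i)\<^sup>2)" if i: "i \<ge> 9216" for i
  proof -
    define r where "r = sqrt (real i)"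
    define N where "N = nat \<lceil>r\<rceil>"
    define l where "l = ln (real i)"
    have r96: "r \<ge> 96" unfolding r_def using i by (intro real_le_rsqrt) auto
    have rr: "r * r = real i" by (simp add: r_def)
    have N: "r \<le> real N" "real N \<le> 2 * r" "N \<ge> 1" using r96 unfolding N_def by linarith+
    have l0: "l \<ge> 0" using i by (simp add: l_def)
    have lN: "ln (real N) \<ge> l / 2"
    proof -
      have "l / 2 = ln r" unfolding l_def r_def using i by (simp add: ln_sqrt)
      also have "\<dots> \<le> ln (real N)" using N r96 by simp
      finally show ?thesis .
    qed
    have b: "nlog i / 96 \<le> real i * l / 24"
    proof -
      have "ln (real i + 1) \<le> ln (real i ^ 2)"
      proof -
        have "real i * 2 \<le> real i * real i" using i by (intro mult_left_mono) auto
        then have "real i + 1 \<le> (real i)\<^sup>2" unfolding power2_eq_square using i by linarith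
        then show ?thesis using i by (subst ln_le_cancel_iff) auto
      qed
      also have "\<dots> = 2 * l" using i by (simp add: l_def ln_realpow)
      finally have "(real i + 1) * ln (real i + 1) \<le> (2 * real i) * (2 * l)"
        using i by (intro mult_mono) auto
      then show ?thesis by (simp add: nlog_def)
    qed
    have "nlog i / 96 / real N - real i * ln (real N) / (6 * real N)
        \<le> (real i * l / 24) / real N - real i * (l / 2) / (6 * real N)"
      using b lN N by (intro diff_mono divide_right_mono mult_left_mono) auto
    also have "\<dots> = - (real i * l / (24 * real N))" using N by (simp add: field_simps)
    also have "\<dots> \<le> - (2 * l)"
    proof -
      have "2 * l * (24 * real N) \<le> 2 * l * (24 * (2 * r))" using l0 N by (intro mult_left_mono) auto
      also have "\<dots> = 96 * (l * r)" by simp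
      also have "\<dots> \<le> r * (l * r)" using l0 r96 by (intro mult_right_mono) auto
      also have "\<dots> = real i * l" using rr by (simp add: mult.left_commute)
      finally show ?thesis using N by (simp add: le_divide_eq)
    qed
    finally have "exp (nlog i / 96 / real N - real i * ln (real N) / (6 * real N)) \<le> exp (- (2 * l))" by simp
    also have "\<dots> = 1 / (real i)\<^sup>2"
      using i by (simp add: l_def exp_minus exp_double inverse_eq_divide)
    finally show ?thesis
      using emeasure_digit_sum_le[OF N(3), of i "nlog i / 96"] ennreal_leI order_trans by blast
  qed
  have "AE x in gmeas 0. eventually (\<lambda>i. x \<in> space (gmeas 0) - ?A i) sequentially"
  proof (rule borel_cantelli_AE1)
    show "?A i \<in> sets (gmeas 0)" for i by measurable
    show "emeasure (gmeas 0) (?A i) < \<infinity>" for i by (simp add: less_top[symmetric])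
    show "summable (\<lambda>i. measure (gmeas 0) (?A i))"
    proof (rule summable_comparison_test')
      show "summable (\<lambda>i. 1 / (real i)\<^sup>2)" using inverse_power_summable[of 2, where ?'a = real]
        by (simp add: inverse_eq_divide)
      fix i :: nat assume "i \<ge> 9216"
      from bound[OF this] show "norm (measure (gmeas 0) (?A i)) \<le> 1 / (real i)\<^sup>2"
        by (simp add: emeasure_eq_measure)
    qed
  qed
  then show ?thesis by eventually_elim (auto elim: eventually_mono)
qed

section \<open>Borel-Cantelli arguments\<close>

text \<open>The index \<open>m = 0\<close> contributes \<open>1 / 0 = 0\<close>.\<close>
definition inv_sq_sum :: "nat set \<Rightarrow> real" where
  "inv_sq_sum Q = (\<Sum>m. if m \<in> Q then 1 / (real m)\<^sup>2 else 0)"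

lemma summable_inv_sq: "summable (\<lambda>m. if m \<in> Q then 1 / (real m)\<^sup>2 else 0)"
proof (rule summable_comparison_test')
  show "summable (\<lambda>m. 1 / (real m)\<^sup>2)"
    using inverse_power_summable[of 2, where ?'a = real] by (simp add: inverse_eq_divide)
qed auto

lemma inv_sq_sum_nonneg: "0 \<le> inv_sq_sum Q"
  unfolding inv_sq_sum_def by (intro suminf_nonneg summable_inv_sq) auto

lemma ennreal_inv_sq_sum:
  "(\<Sum>m. indicator Q (Suc m) * ennreal (1 / (real (Suc m))\<^sup>2)) = ennreal (inv_sq_sum Q)"
proof -
  let ?f = "\<lambda>m. if m \<in> Q then 1 / (real m)\<^sup>2 else 0"
  have "inv_sq_sum Q = (\<Sum>m. ?f (Suc m))"
    unfolding inv_sq_sum_def using suminf_split_head[OF summable_inv_sq[of Q]] by simp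
  also have "ennreal \<dots> = (\<Sum>m. ennreal (?f (Suc m)))"
  proof (intro suminf_ennreal2[symmetric])
    show "summable (\<lambda>m. ?f (Suc m))"
      using summable_inv_sq[of Q] by (subst summable_Suc_iff)
  qed auto
  also have "\<dots> = (\<Sum>m. indicator Q (Suc m) * ennreal (1 / (real (Suc m))\<^sup>2))"
    by (intro suminf_cong) auto
  finally show ?thesis by simp
qed

lemma emeasure_digit_le:
  "emeasure (gmeas 0) {x. digit i x \<in> Q} \<le> ennreal (2 * inv_sq_sum Q)"
proof -
  define h where "h = (\<lambda>k m. if k = i then indicator Q m else 1 :: ennreal)"
  define c where "c = (\<lambda>k. if k = i then 2 * ennreal (inv_sq_sum Q) else 1)"
  have "emeasure (gmeas 0) {x. digit i x \<in> Q} = (\<integral>\<^sup>+x. indicator {x. digit i x \<in> Q} x \<partial>gmeas 0)"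
    by (rule nn_integral_indicator[symmetric]) measurable
  also have "\<dots> = (\<integral>\<^sup>+x. (\<Prod>k<Suc i. h k (digit k x)) \<partial>gmeas 0)"
  proof (rule nn_integral_cong)
    fix x
    have "(\<Prod>k<i. h k (digit k x)) = 1" by (intro prod.neutral) (auto simp: h_def)
    then show "indicator {x. digit i x \<in> Q} x = (\<Prod>k<Suc i. h k (digit k x))"
      by (simp add: h_def split: split_indicator)
  qed
  also have "\<dots> \<le> (\<Prod>k<Suc i. c k)"
  proof (rule nn_integral_prod_digits_le)
    fix k and s :: real assume s: "s \<in> {0..1}"
    show "(\<integral>\<^sup>+x. h k (digit 0 x) \<partial>gmeas s) \<le> c k"
      using nn_integral_first_digit_upper[OF s, of "indicator Q"] gmeas_prob[of s] s
      by (simp add: h_def c_def ennreal_inv_sq_sum del: of_nat_Suc)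
  qed simp
  also have "(\<Prod>k<i. c k) = 1" by (intro prod.neutral) (auto simp: c_def)
  then have "(\<Prod>k<Suc i. c k) = ennreal (2 * inv_sq_sum Q)"
    by (simp add: c_def ennreal_mult inv_sq_sum_nonneg)
  finally show ?thesis .
qed

section \<open>Convergent case\<close>

lemma AE_gmeas_0: "(AE x in gmeas 0. P x) \<longleftrightarrow> (AE x in lborel. x \<in> {0<..<1} \<longrightarrow> P x)"
  unfolding gmeas_def by (subst AE_density) (auto simp: gdens_def split: split_indicator intro!: AE_cong)

lemma digit_sum_pos:
  assumes x: "x \<in> {0<..<1}" and i: "i \<ge> 1"
  shows "digit_sum i x > 0"
proof -
  have "1 \<le> 1 / x" using x by (simp add: le_divide_eq)
  then have "digit 0 x \<ge> 1" by (simp add: digit_def cf_digit_def Suc_le_eq del: zero_less_divide_1_iff)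
  then have "0 < real (digit 0 x)" by simp
  also have "\<dots> \<le> digit_sum i x"
    unfolding digit_sum_def using i by (intro member_le_sum) auto
  finally show ?thesis .
qed

lemma nlog_at_top: "filterlim nlog at_top sequentially"
proof (rule filterlim_at_top_mono)
  show "filterlim (\<lambda>i. ln (real i + 1)) at_top sequentially"
  proof (rule filterlim_compose[OF ln_at_top])
    show "filterlim (\<lambda>i. real i + 1) at_top sequentially"
      by (rule filterlim_at_top_mono[OF filterlim_real_sequentially]) simp
  qed
  show "eventually (\<lambda>i. ln (real i + 1) \<le> nlog i) sequentially"
    by (auto simp: nlog_def algebra_simps)
qed

definition prime_exceed :: "(real \<Rightarrow> real) \<Rightarrow> real \<Rightarrow> nat set" where
  "prime_exceed g z = {m. prime m \<and> z \<le> g (real m)}"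

theorem AE_tendsto_0:
  fixes g :: "real \<Rightarrow> real"
  assumes g: "\<And>t. t \<ge> 0 \<Longrightarrow> g t > 0"
    and sum: "\<And>e. e > 0 \<Longrightarrow> summable (\<lambda>i. inv_sq_sum (prime_exceed g (e * nlog i)))"
  shows "AE x in gmeas 0. (\<lambda>i. g (real (prime_digit (Suc i) x)) / digit_sum i x) \<longlonglongrightarrow> 0"
proof -
  interpret finite_measure "gmeas 0"
    using gmeas_prob[of 0] by (intro finite_measureI) auto
  let ?A = "\<lambda>j i. {x. digit i x \<in> prime_exceed g (1 / real (Suc j) * nlog i)}"
  have "AE x in gmeas 0. eventually (\<lambda>i. x \<in> space (gmeas 0) - ?A j i) sequentially" for j
  proof (rule borel_cantelli_AE1)
    show "?A j i \<in> sets (gmeas 0)" for i by measurable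
    show "emeasure (gmeas 0) (?A j i) < \<infinity>" for i by (simp add: less_top[symmetric])
    show "summable (\<lambda>i. measure (gmeas 0) (?A j i))"
    proof (rule summable_comparison_test')
      show "summable (\<lambda>i. 2 * inv_sq_sum (prime_exceed g (1 / real (Suc j) * nlog i)))"
        by (intro summable_mult sum) simp
      show "norm (measure (gmeas 0) (?A j i)) \<le> 2 * inv_sq_sum (prime_exceed g (1 / real (Suc j) * nlog i))" for i
        using emeasure_digit_le[of i "prime_exceed g (1 / real (Suc j) * nlog i)"] inv_sq_sum_nonneg
        by (simp add: emeasure_eq_measure del: of_nat_Suc)
    qed
  qed
  then have "AE x in gmeas 0. \<forall>j. eventually (\<lambda>i. x \<in> space (gmeas 0) - ?A j i) sequentially"
    by (simp add: AE_all_countable)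
  with AE_digit_sum_lower show ?thesis
  proof eventually_elim
    case (elim x)
    show ?case
    proof (rule tendstoI)
      fix e :: real assume e: "e > 0"
      \<comment> \<open>The level must lie below \<open>e / 96\<close>, since the digit sum is only
        known to exceed \<open>nlog i / 96\<close>. Levels of the form \<open>1 / Suc j\<close> keep
        the exceptional null sets countable in number.\<close>
      obtain j where j: "96 / e < real (Suc j)" using reals_Archimedean2 less_Suc_eq
        by (metis of_nat_Suc add.commute less_add_one order.strict_trans)
      have "eventually (\<lambda>i. x \<in> space (gmeas 0) - ?A j i) sequentially" using elim by blast
      \<comment> \<open>A non-prime digit makes the numerator \<open>g 0\<close>, a fixed positive
        number that the denominator has to outgrow.\<close>
      moreover have "eventually (\<lambda>i. nlog i > max 0 (96 * g 0 / e)) sequentially"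
        using nlog_at_top unfolding filterlim_at_top_dense by blast
      ultimately show "eventually (\<lambda>i. dist (g (real (prime_digit (Suc i) x)) / digit_sum i x) 0 < e) sequentially"
        using elim(1)
      proof eventually_elim
        case (elim i)
        have S: "nlog i / 96 < digit_sum i x" "nlog i > 0" using elim by auto
        then have S0: "digit_sum i x > 0" by linarith
        have "g (real (prime_digit (Suc i) x)) < e * (nlog i / 96)"
        proof (cases "prime (digit i x)")
          case True
          then have "g (real (digit i x)) < 1 / real (Suc j) * nlog i"
            using elim(1) by (auto simp: prime_exceed_def)
          also have "\<dots> \<le> (e / 96) * nlog i"
            using j e S by (intro mult_right_mono) (auto simp: field_simps simp del: of_nat_Suc)
          finally show ?thesis using True by (simp add: prime_digit_def digit_def)
        next
          case False
          then show ?thesis using elim(2) e by (simp add: prime_digit_def digit_def field_simps)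
        qed
        also have "\<dots> < e * digit_sum i x" using S e by simp
        finally show ?case using S0 g[of "real (prime_digit (Suc i) x)"]
          by (simp add: divide_less_eq)
      qed
    qed
  qed
qed

section \<open>Divergent case: exceedances occur\<close>

lemma nn_integral_first_digit_avoid:
  assumes s: "s \<in> {0..1}"
  shows "(\<integral>\<^sup>+x. indicator (- Q) (digit 0 x) \<partial>gmeas s) \<le> ennreal (exp (- (inv_sq_sum Q / 3)))"
proof -
  have "ennreal (inv_sq_sum Q / 3) = ennreal (1 / 3) * (\<Sum>m. indicator Q (Suc m) * ennreal (1 / (real (Suc m))\<^sup>2))"
    unfolding ennreal_inv_sq_sum using inv_sq_sum_nonneg by (subst ennreal_mult[symmetric]) auto
  also have "\<dots> = (\<Sum>m. ennreal (1 / 3) * (indicator Q (Suc m) * ennreal (1 / (real (Suc m))\<^sup>2)))"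
    by (simp only: ennreal_suminf_cmult)
  also have "\<dots> \<le> (\<Sum>m. ennreal (digit_prob s (Suc m)) * indicator Q (Suc m))"
  proof (intro suminf_le summableI)
    fix m
    have "ennreal (1 / 3) * ennreal (1 / (real (Suc m))\<^sup>2) = ennreal (1 / (3 * (real (Suc m))\<^sup>2))"
      by (subst ennreal_mult[symmetric]) auto
    also have "\<dots> \<le> ennreal (digit_prob s (Suc m))"
      by (intro ennreal_leI digit_prob_bounds s) simp
    finally show "ennreal (1 / 3) * (indicator Q (Suc m) * ennreal (1 / (real (Suc m))\<^sup>2))
       \<le> ennreal (digit_prob s (Suc m)) * indicator Q (Suc m)"
      by (auto split: split_indicator)
  qed
  also have "\<dots> = (\<integral>\<^sup>+x. indicator Q (digit 0 x) \<partial>gmeas s)"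
    using s by (subst nn_integral_first_digit) auto
  finally have low: "ennreal (inv_sq_sum Q / 3) \<le> (\<integral>\<^sup>+x. indicator Q (digit 0 x) \<partial>gmeas s)" .
  have "(\<integral>\<^sup>+x. indicator (- Q) (digit 0 x) \<partial>gmeas s) + (\<integral>\<^sup>+x. indicator Q (digit 0 x) \<partial>gmeas s)
     = (\<integral>\<^sup>+x. indicator (- Q) (digit 0 x) + indicator Q (digit 0 x) \<partial>gmeas s)"
    by (rule nn_integral_add[symmetric]) measurable
  also have "\<dots> = (\<integral>\<^sup>+x. 1 \<partial>gmeas s)" by (intro nn_integral_cong) (auto split: split_indicator)
  also have "\<dots> = 1" using gmeas_prob[of s] s by simp
  finally have "(\<integral>\<^sup>+x. indicator (- Q) (digit 0 x) \<partial>gmeas s) + ennreal (inv_sq_sum Q / 3) \<le> 1"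
    using low by (metis add_left_mono)
  then have "(\<integral>\<^sup>+x. indicator (- Q) (digit 0 x) \<partial>gmeas s) \<le> 1 - ennreal (inv_sq_sum Q / 3)"
    by (metis ennreal_add_diff_cancel_right ennreal_minus_mono ennreal_neq_top infinity_ennreal_def order_refl)
  also have "\<dots> = ennreal (1 - inv_sq_sum Q / 3)"
    using inv_sq_sum_nonneg by (subst ennreal_1[symmetric], subst ennreal_minus) auto
  also have "\<dots> \<le> ennreal (exp (- (inv_sq_sum Q / 3)))"
    using exp_ge_add_one_self[of "- (inv_sq_sum Q / 3)"] by (intro ennreal_leI) simp
  finally show ?thesis .
qed

text \<open>A second Borel-Cantelli lemma without independence: whatever the past, digit
  \<open>k\<close> avoids \<open>Q k\<close> with probability at most
  \<open>exp (- (inv_sq_sum (Q k) / 3))\<close>, and the product of these bounds tends to 0. Setting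
  \<open>q k = 0\<close> before \<open>N\<close> lets the product run over all
  \<open>k < n\<close>.\<close>

lemma emeasure_digits_avoid:
  assumes div: "\<not> summable (\<lambda>i. inv_sq_sum (Q i))"
  shows "emeasure (gmeas 0) {x. \<forall>k\<ge>N. digit k x \<notin> Q k} = 0"
proof -
  define q where "q = (\<lambda>k. if k < N then 0 else inv_sq_sum (Q k))"
  have q0: "q k \<ge> 0" for k by (simp add: q_def inv_sq_sum_nonneg)
  let ?B = "{x. \<forall>k\<ge>N. digit k x \<notin> Q k}"
  have B: "emeasure (gmeas 0) ?B \<le> ennreal (exp (- ((\<Sum>k<n. q k) / 3)))" for n
  proof -
    define h where "h = (\<lambda>k m. if k < N then 1 else indicator (- Q k) m :: ennreal)"
    have "emeasure (gmeas 0) ?B = (\<integral>\<^sup>+x. indicator ?B x \<partial>gmeas 0)"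
      by (rule nn_integral_indicator[symmetric]) measurable
    also have "\<dots> \<le> (\<integral>\<^sup>+x. (\<Prod>k<n. h k (digit k x)) \<partial>gmeas 0)"
    proof (rule nn_integral_mono)
      fix x
      have "(\<Prod>k<n. h k (digit k x)) = 1" if "x \<in> ?B"
        using that by (intro prod.neutral) (auto simp: h_def)
      then show "indicator ?B x \<le> (\<Prod>k<n. h k (digit k x))" by (auto split: split_indicator)
    qed
    also have "\<dots> \<le> (\<Prod>k<n. ennreal (exp (- (q k / 3))))"
    proof (rule nn_integral_prod_digits_le)
      fix k and s :: real assume s: "s \<in> {0..1}"
      show "(\<integral>\<^sup>+x. h k (digit 0 x) \<partial>gmeas s) \<le> ennreal (exp (- (q k / 3)))"
        using nn_integral_first_digit_avoid[OF s, of "Q k"] gmeas_prob[of s] s by (simp add: h_def q_def)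
    qed simp
    also have "\<dots> = ennreal (exp (- ((\<Sum>k<n. q k) / 3)))"
      by (simp add: prod_ennreal exp_sum[symmetric] sum_negf sum_divide_distrib)
    finally show ?thesis .
  qed
  have "\<not> summable q"
  proof
    assume "summable q"
    then have "summable (\<lambda>i. inv_sq_sum (Q i))"
      by (rule summable_cong[THEN iffD1, rotated]) (use eventually_ge_at_top[of N] in eventually_elim, auto simp: q_def)
    then show False using div by simp
  qed
  have small: "emeasure (gmeas 0) ?B \<le> ennreal e" if e: "e > 0" for e
  proof -
    obtain n where "(\<Sum>k<n. q k) > 3 * \<bar>ln e\<bar>"
      using \<open>\<not> summable q\<close> summableI_nonneg_bounded[of q "3 * \<bar>ln e\<bar>"] q0 by (meson not_le)
    then have "exp (- ((\<Sum>k<n. q k) / 3)) \<le> exp (ln e)" by simp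
    then have "ennreal (exp (- ((\<Sum>k<n. q k) / 3))) \<le> ennreal e" using e by (intro ennreal_leI) simp
    then show ?thesis using B[of n] by (rule order_trans[rotated])
  qed
  have "emeasure (gmeas 0) ?B \<le> 0" by (rule ennreal_le_epsilon) (simp add: small)
  then show ?thesis by simp
qed

section \<open>The digit sum before the first exceedance\<close>

lemma harm_le_ln_plus_1:
  assumes "n \<ge> 1"
  shows "harm n \<le> ln (real n) + 1"
proof -
  have "harm (Suc (n - 1)) - ln (real (Suc (n - 1))) \<le> harm (Suc 0) - ln (real (Suc 0))"
    using decseq_harm_diff_ln by (rule decseqD) simp
  then show ?thesis using assms by (simp add: harm_def)
qed

text \<open>The weight combines a union bound for digits above \<open>V\<close> with Markov's
  inequality for the truncated sum at level \<open>b\<close>. The tail of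
  \<open>1 / m\<^sup>2\<close> telescopes to at most \<open>1 / V\<close>; the head is
  \<open>harm V / b\<close>.\<close>

lemma digit_truncation_bound:
  fixes V :: nat and b :: real
  assumes V: "V \<ge> 1" and b: "b > 0"
  shows "(\<Sum>m. ennreal (if Suc m > V then 1 else real (Suc m) / b) * ennreal (1 / (real (Suc m))\<^sup>2))
     \<le> ennreal (1 / real V + (1 + ln (real V)) / b)"
proof -
  define f where "f = (\<lambda>m. (if Suc m > V then 1 else real (Suc m) / b) * (1 / (real (Suc m))\<^sup>2))"
  have f0: "f m \<ge> 0" for m using b by (simp add: f_def)
  have base: "(\<Sum>m<V. f m) = harm V / b"
  proof -
    have "harm V = (\<Sum>m<V. inverse (real (Suc m)))"
      unfolding harm_def by (simp add: sum.atLeast1_atMost_eq)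
    moreover have "inverse (real (Suc m)) / b = f m" if "m < V" for m
      using that b by (simp add: f_def field_simps power2_eq_square del: of_nat_Suc)
    ultimately show ?thesis by (simp add: sum_divide_distrib)
  qed
  have part: "(\<Sum>m<V+n. f m) \<le> harm V / b + 1 / real V - 1 / real (V + n)" for n
  proof (induction n)
    case 0 then show ?case using base by simp
  next
    case (Suc n)
    have a: "real (V + n) > 0" using V by simp
    have "f (V + n) = 1 / (real (Suc (V + n)))\<^sup>2" by (simp add: f_def)
    also have "\<dots> \<le> 1 / (real (V + n) * real (Suc (V + n)))"
      unfolding power2_eq_square using a by (intro divide_left_mono mult_right_mono) auto
    also have "\<dots> = 1 / real (V + n) - 1 / real (V + Suc n)"
      using a by (simp add: field_simps)
    finally show ?case using Suc by simp
  qed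
  have "(\<Sum>m. ennreal (f m)) \<le> ennreal (1 / real V + (1 + ln (real V)) / b)"
  proof (rule suminf_le_const[OF summableI])
    fix n
    have "(\<Sum>m<n. f m) \<le> (\<Sum>m<V+n. f m)" using f0 by (intro sum_mono2) auto
    also have "\<dots> \<le> harm V / b + 1 / real V" using part[of n] by (smt (verit) divide_nonneg_nonneg of_nat_0_le_iff)
    also have "\<dots> \<le> (1 + ln (real V)) / b + 1 / real V"
      using harm_le_ln_plus_1[of V] V b by (intro add_right_mono divide_right_mono) auto
    finally show "(\<Sum>m<n. ennreal (f m)) \<le> ennreal (1 / real V + (1 + ln (real V)) / b)"
      using f0 by (simp add: sum_ennreal add.commute ennreal_leI)
  qed
  moreover have "ennreal (f m) = ennreal (if Suc m > V then 1 else real (Suc m) / b) * ennreal (1 / (real (Suc m))\<^sup>2)" for m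
    unfolding f_def using b by (subst ennreal_mult) auto
  ultimately show ?thesis by simp
qed

text \<open>The indicator of \<open>F\<close> is a product of digit weights \<open>r\<close>, so
  \<open>nn_integral_digit_mult_prod_le\<close> applies at every earlier place, where
  \<open>1 \<notin> Q k\<close> makes digit 1 admissible. If the sum exceeds \<open>b\<close>,
  either some digit exceeds \<open>V\<close> or the digits divided by \<open>b\<close> add up to
  more than 1; in both cases the values of \<open>f\<close> sum to at least 1.\<close>

lemma first_exceed_digit_sum_le:
  fixes Q :: "nat \<Rightarrow> nat set" and i N V :: nat and b :: real
  assumes Q1: "\<And>k. 1 \<notin> Q k" and V: "V \<ge> 1" and b: "b > 0"
  defines "F \<equiv> {x. digit i x \<in> Q i \<and> (\<forall>k\<in>{N..<i}. digit k x \<notin> Q k)}"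
  shows "emeasure (gmeas 0) {x\<in>F. digit_sum i x > b}
     \<le> ennreal (real i * 24 * (1 / real V + (1 + ln (real V)) / b)) * emeasure (gmeas 0) F"
proof -
  define r where "r = (\<lambda>k m. if k = i then indicator (Q i) m else if k < N then 1 else indicator (- Q k) m :: ennreal)"
  define f where "f = (\<lambda>m. ennreal (if m > V then 1 else real m / b))"
  define B where "B = 1 / real V + (1 + ln (real V)) / b"
  have B0: "B \<ge> 0" using V b by (simp add: B_def)
  have [measurable]: "F \<in> sets borel" unfolding F_def by measurable
  have ind: "indicator F x = (\<Prod>k<Suc i. r k (digit k x))" for x
  proof (cases "x \<in> F")
    case True
    then have "(\<Prod>k<i. r k (digit k x)) = 1" by (intro prod.neutral) (auto simp: r_def F_def)
    then show ?thesis using True by (simp add: r_def F_def)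
  next
    case False
    then consider "digit i x \<notin> Q i" | k where "N \<le> k" "k < i" "digit k x \<in> Q k" by (auto simp: F_def)
    then show ?thesis
    proof cases
      case 1 then show ?thesis using False by (simp add: r_def)
    next
      case 2
      then have "(\<Prod>k<i. r k (digit k x)) = 0" by (intro prod_zero) (auto simp: r_def intro!: bexI[of _ k])
      then show ?thesis using False by simp
    qed
  qed
  have "emeasure (gmeas 0) {x\<in>F. digit_sum i x > b} = (\<integral>\<^sup>+x. indicator {x\<in>F. digit_sum i x > b} x \<partial>gmeas 0)"
    by (rule nn_integral_indicator[symmetric]) measurable
  also have "\<dots> \<le> (\<integral>\<^sup>+x. (\<Sum>j<i. f (digit j x) * indicator F x) \<partial>gmeas 0)"
  proof (rule nn_integral_mono)
    fix x
    show "indicator {x\<in>F. digit_sum i x > b} x \<le> (\<Sum>j<i. f (digit j x) * indicator F x)"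
    proof (cases "x \<in> F \<and> digit_sum i x > b")
      case True
      have "1 \<le> (\<Sum>j<i. f (digit j x))"
      proof (cases "\<exists>j<i. digit j x > V")
        case True
        then obtain j where "j < i" "digit j x > V" by blast
        then have "1 = f (digit j x)" by (simp add: f_def)
        also have "\<dots> \<le> (\<Sum>j<i. f (digit j x))" using \<open>j < i\<close> by (intro member_le_sum) auto
        finally show ?thesis .
      next
        case False
        then have "(\<Sum>j<i. f (digit j x)) = (\<Sum>j<i. ennreal (real (digit j x) / b))"
          by (intro sum.cong) (auto simp: f_def)
        also have "\<dots> = ennreal (digit_sum i x / b)"
          using b by (simp add: sum_ennreal digit_sum_def sum_divide_distrib)
        finally show ?thesis using True b by simp
      qed
      then show ?thesis using True by (simp add: sum_distrib_right[symmetric])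
    qed simp
  qed
  also have "\<dots> = (\<Sum>j<i. \<integral>\<^sup>+x. f (digit j x) * (\<Prod>k<Suc i. r k (digit k x)) \<partial>gmeas 0)"
    unfolding ind by (rule nn_integral_sum) measurable
  also have "\<dots> \<le> (\<Sum>j<i. 24 * ennreal B * emeasure (gmeas 0) F)"
  proof (rule sum_mono)
    fix j assume "j \<in> {..<i}"
    then have j: "j < i" by simp
    have "(\<integral>\<^sup>+x. f (digit j x) * (\<Prod>k<Suc i. r k (digit k x)) \<partial>gmeas 0)
      \<le> 24 * (\<Sum>m. f (Suc m) * ennreal (1 / (real (Suc m))\<^sup>2)) * (\<integral>\<^sup>+x. (\<Prod>k<Suc i. r k (digit k x)) \<partial>gmeas 0)"
      by (rule nn_integral_digit_mult_prod_le) (use j Q1 in \<open>auto simp: r_def split: split_indicator\<close>)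
    also have "\<dots> \<le> 24 * ennreal B * (\<integral>\<^sup>+x. (\<Prod>k<Suc i. r k (digit k x)) \<partial>gmeas 0)"
      unfolding f_def B_def by (intro mult_left_mono mult_right_mono digit_truncation_bound V b) auto
    also have "(\<integral>\<^sup>+x. (\<Prod>k<Suc i. r k (digit k x)) \<partial>gmeas 0) = emeasure (gmeas 0) F"
      unfolding ind[symmetric] by (rule nn_integral_indicator) measurable
    finally show "(\<integral>\<^sup>+x. f (digit j x) * (\<Prod>k<Suc i. r k (digit k x)) \<partial>gmeas 0) \<le> 24 * ennreal B * emeasure (gmeas 0) F" .
  qed
  also have "\<dots> = ennreal (real i * 24 * B) * emeasure (gmeas 0) F"
    using B0 by (simp add: ennreal_mult ennreal_of_nat_eq_real_of_nat mult.assoc)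
  finally show ?thesis unfolding B_def .
qed

text \<open>With \<open>V = K * Suc i\<close> and \<open>b = K\<^sup>2 * nlog i\<close>, the large
  digits contribute at most \<open>1 / K\<close> and the truncated mean at most
  \<open>2 / K\<close>, whence \<open>72 = 24 * (1 + 2)\<close>. The square in \<open>b\<close>
  makes room for the \<open>ln K\<close> inside \<open>ln V\<close>: one factor \<open>K\<close>
  absorbs \<open>1 + ln K\<close>, the other survives.\<close>

lemma truncation_estimate:
  fixes K i :: nat
  assumes K: "K \<ge> 1" and i: "i \<ge> 2"
  shows "real i * 24 * (1 / real (K * Suc i) + (1 + ln (real (K * Suc i))) / ((real K)\<^sup>2 * nlog i)) \<le> 72 / real K"
proof -
  define l where "l = ln (real i + 1)"
  have "exp 1 \<le> real i + 1" using exp_le i by linarith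
  then have l1: "l \<ge> 1" unfolding l_def using i by (subst ln_ge_iff) auto
  have K1: "real K \<ge> 1" using K by simp
  have lK: "0 \<le> ln (real K)" "ln (real K) \<le> real K - 1" using K1 ln_le_minus_one[of "real K"] by auto
  have lnV: "ln (real (K * Suc i)) = ln (real K) + l"
    using K1 ln_mult[of "real K" "real i + 1"] by (simp add: l_def algebra_simps)
  have "real i * (1 / real (K * Suc i)) = 1 / real K * (real i / real (Suc i))"
    by (simp only: of_nat_mult) simp
  also have "\<dots> \<le> 1 / real K * 1" by (intro mult_left_mono) auto
  finally have a: "real i * (1 / real (K * Suc i)) \<le> 1 / real K" by simp
  have "1 + ln (real (K * Suc i)) \<le> 2 * real K * l"
  proof -
    have "1 + ln (real K) \<le> (1 + ln (real K)) * l" using l1 lK by (simp add: mult_le_cancel_left1)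
    also have "\<dots> \<le> real K * l" using l1 lK by (intro mult_right_mono) auto
    finally have "1 + ln (real K) \<le> real K * l" .
    moreover have "1 * l \<le> real K * l" using l1 K1 by (intro mult_right_mono) auto
    moreover have "2 * real K * l = real K * l + real K * l" by simp
    ultimately show ?thesis unfolding lnV by linarith
  qed
  then have "real i * (1 + ln (real (K * Suc i))) \<le> (real i + 1) * (2 * real K * l)"
    using lK l1 lnV by (intro mult_mono) auto
  then have "real i * (1 + ln (real (K * Suc i))) / ((real K)\<^sup>2 * nlog i) \<le> (real i + 1) * (2 * real K * l) / ((real K)\<^sup>2 * nlog i)"
    by (rule divide_right_mono) (auto simp: nlog_def)
  also have "\<dots> = 2 / real K"
  proof -
    have "(x * (2 * k * l)) / (k\<^sup>2 * (x * l)) = 2 / k" if "x > 0" "k > 0" for x k :: real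
      using that l1 by (simp add: field_simps power2_eq_square)
    from this[of "real i + 1" "real K"] show ?thesis unfolding nlog_def l_def[symmetric] using K1 by simp
  qed
  finally have "real i * ((1 + ln (real (K * Suc i))) / ((real K)\<^sup>2 * nlog i)) \<le> 2 / real K" by simp
  then have "24 * (real i * (1 / real (K * Suc i)) + real i * ((1 + ln (real (K * Suc i))) / ((real K)\<^sup>2 * nlog i)))
      \<le> 24 * (1 / real K + 2 / real K)"
    using a by (intro mult_left_mono add_mono) auto
  also have "\<dots> = 72 / real K" by simp
  finally show ?thesis by (simp only: ring_distribs mult_ac)
qed

text \<open>Decomposes according to the first \<open>i \<ge> N\<close> with \<open>digit i x \<in> Q i\<close>: conditionally on that
  index, the preceding digit sum is still at most of order \<open>nlog i\<close> with large probability.\<close>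
lemma emeasure_exceed_with_small_sum:
  fixes Q :: "nat \<Rightarrow> nat set" and K N :: nat
  assumes Q1: "\<And>k. 1 \<notin> Q k" and div: "\<not> summable (\<lambda>i. inv_sq_sum (Q i))"
    and K: "K \<ge> 1" and N: "N \<ge> 2"
  shows "1 \<le> emeasure (gmeas 0) {x. \<exists>i\<ge>N. digit i x \<in> Q i \<and> digit_sum i x \<le> (real K)\<^sup>2 * nlog i} + ennreal (72 / real K)"
proof -
  let ?G = "{x. \<exists>i\<ge>N. digit i x \<in> Q i \<and> digit_sum i x \<le> (real K)\<^sup>2 * nlog i}"
  let ?Z = "{x. \<forall>k\<ge>N. digit k x \<notin> Q k}"
  define F where "F = (\<lambda>i. {x. digit i x \<in> Q i \<and> (\<forall>k\<in>{N..<i}. digit k x \<notin> Q k)})"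
  define B where "B = (\<lambda>i. {x\<in>F (N + i). digit_sum (N + i) x > (real K)\<^sup>2 * nlog (N + i)})"
  have Fm [measurable]: "F i \<in> sets borel" for i unfolding F_def by measurable
  have Bm [measurable]: "B i \<in> sets borel" for i unfolding B_def by measurable
  have cover: "UNIV \<subseteq> (?Z \<union> ?G) \<union> (\<Union>i. B i)"
  proof
    fix x :: real
    show "x \<in> (?Z \<union> ?G) \<union> (\<Union>i. B i)"
    proof (cases "x \<in> ?Z")
      case False
      then have ex: "\<exists>k. N \<le> k \<and> digit k x \<in> Q k" by auto
      define i where "i = (LEAST k. N \<le> k \<and> digit k x \<in> Q k)"
      have i: "N \<le> i" "digit i x \<in> Q i" using LeastI_ex[OF ex] by (auto simp: i_def)
      have "digit k x \<notin> Q k" if "N \<le> k" "k < i" for k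
        using not_less_Least[of k "\<lambda>k. N \<le> k \<and> digit k x \<in> Q k"] that by (auto simp: i_def)
      then have "x \<in> F i" using i by (auto simp: F_def)
      then have "x \<in> ?G \<or> x \<in> B (i - N)" using i by (auto simp: B_def)
      then show ?thesis by blast
    qed simp
  qed
  have bad: "emeasure (gmeas 0) (B i) \<le> ennreal (72 / real K) * emeasure (gmeas 0) (F (N + i))" for i
  proof -
    have "nlog (N + i) > 0" using N by (auto simp: nlog_def)
    then have b: "(real K)\<^sup>2 * nlog (N + i) > 0" using K by auto
    have "emeasure (gmeas 0) (B i) \<le> ennreal (real (N + i) * 24 * (1 / real (K * Suc (N + i)) +
        (1 + ln (real (K * Suc (N + i)))) / ((real K)\<^sup>2 * nlog (N + i)))) * emeasure (gmeas 0) (F (N + i))"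
      unfolding B_def F_def by (rule first_exceed_digit_sum_le) (use Q1 b K in auto)
    also have "\<dots> \<le> ennreal (72 / real K) * emeasure (gmeas 0) (F (N + i))"
      using N by (intro mult_right_mono ennreal_leI truncation_estimate K) auto
    finally show ?thesis .
  qed
  \<comment> \<open>The first-exceedance events are disjoint, so their measures sum to at most 1 and
    the bad parts together to at most \<open>72 / K\<close>.\<close>
  have "(\<Sum>i. emeasure (gmeas 0) (F (N + i))) = emeasure (gmeas 0) (\<Union>i. F (N + i))"
  proof (rule suminf_emeasure)
    show "disjoint_family (\<lambda>i. F (N + i))"
      unfolding disjoint_family_on_def
    proof (intro ballI impI)
      fix m n :: nat assume "m \<noteq> n"
      then consider "m < n" | "n < m" by linarith
      then show "F (N + m) \<inter> F (N + n) = {}" by cases (force simp: F_def)+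
    qed
  qed auto
  also have "\<dots> \<le> emeasure (gmeas 0) UNIV" by (rule emeasure_mono) auto
  finally have sF: "(\<Sum>i. emeasure (gmeas 0) (F (N + i))) \<le> 1" using gmeas_prob[of 0] by simp
  have Zm: "?Z \<in> sets (gmeas 0)" and Gm: "?G \<in> sets (gmeas 0)" by measurable
  have "1 = emeasure (gmeas 0) UNIV" using gmeas_prob[of 0] by simp
  also have "\<dots> \<le> emeasure (gmeas 0) ((?Z \<union> ?G) \<union> (\<Union>i. B i))"
    by (rule emeasure_mono[OF cover]) (use Zm Gm in auto)
  also have "\<dots> \<le> emeasure (gmeas 0) (?Z \<union> ?G) + emeasure (gmeas 0) (\<Union>i. B i)"
    by (rule emeasure_subadditive) (use Zm Gm in auto)
  also have "\<dots> \<le> (emeasure (gmeas 0) ?Z + emeasure (gmeas 0) ?G) + (\<Sum>i. emeasure (gmeas 0) (B i))"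
    by (intro add_mono emeasure_subadditive emeasure_subadditive_countably) (use Zm Gm in auto)
  also have "emeasure (gmeas 0) ?Z = 0" by (rule emeasure_digits_avoid[OF div])
  also have "(\<Sum>i. emeasure (gmeas 0) (B i)) \<le> (\<Sum>i. ennreal (72 / real K) * emeasure (gmeas 0) (F (N + i)))"
    by (intro suminf_le summableI bad)
  also have "\<dots> = ennreal (72 / real K) * (\<Sum>i. emeasure (gmeas 0) (F (N + i)))"
    by (rule ennreal_suminf_cmult)
  also have "\<dots> \<le> ennreal (72 / real K) * 1" using sF by (rule mult_left_mono) simp
  finally show ?thesis by simp
qed

text \<open>The event \<open>Y a N\<close> does not involve \<open>K\<close>. Divergence at the
  level \<open>M = (a + 1) * (K + 1)\<^sup>2\<close> shows that its measure is at least
  \<open>1 - 72 / (K + 1)\<close>; letting \<open>K\<close> grow with \<open>a\<close> and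
  \<open>N\<close> fixed gives measure 1. This is why divergence is wanted for every
  \<open>M\<close>.\<close>

theorem AE_limsup_infinity:
  fixes g :: "real \<Rightarrow> real"
  assumes div: "\<And>M. M > 0 \<Longrightarrow> \<not> summable (\<lambda>i. inv_sq_sum (prime_exceed g (M * nlog i)))"
  shows "AE x in gmeas 0. limsup (\<lambda>i. ereal (g (real (prime_digit (Suc i) x)) / digit_sum i x)) = \<infinity>"
proof -
  interpret finite_measure "gmeas 0"
    using gmeas_prob[of 0] by (intro finite_measureI) auto
  define Y where "Y = (\<lambda>a N. {x. \<exists>i\<ge>N. prime (digit i x) \<and> real (Suc a) * digit_sum i x \<le> g (real (digit i x))})"
  have [measurable]: "Y a N \<in> sets borel" for a N unfolding Y_def by measurable
  have full: "emeasure (gmeas 0) (Y a N) = 1" if N: "N \<ge> 2" for a N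
  proof -
    have "1 \<le> measure (gmeas 0) (Y a N) + 72 / real (Suc K)" for K
    proof -
      let ?M = "real (Suc a) * (real (Suc K))\<^sup>2"
      let ?G = "{x. \<exists>i\<ge>N. digit i x \<in> prime_exceed g (?M * nlog i) \<and> digit_sum i x \<le> (real (Suc K))\<^sup>2 * nlog i}"
      have "?G \<subseteq> Y a N"
      proof
        fix x assume "x \<in> ?G"
        then obtain i where i: "i \<ge> N" "prime (digit i x)" "?M * nlog i \<le> g (real (digit i x))"
          "digit_sum i x \<le> (real (Suc K))\<^sup>2 * nlog i" by (auto simp: prime_exceed_def)
        have "real (Suc a) * digit_sum i x \<le> real (Suc a) * ((real (Suc K))\<^sup>2 * nlog i)"
          using i by (intro mult_left_mono) auto
        also have "\<dots> \<le> g (real (digit i x))" using i(3) by (simp only: mult.assoc)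
        finally show "x \<in> Y a N" using i by (auto simp: Y_def)
      qed
      then have "emeasure (gmeas 0) ?G \<le> emeasure (gmeas 0) (Y a N)" by (intro emeasure_mono) auto
      moreover have "1 \<le> emeasure (gmeas 0) ?G + ennreal (72 / real (Suc K))"
        by (rule emeasure_exceed_with_small_sum) (use div[of ?M] N in \<open>auto simp: prime_exceed_def\<close>)
      ultimately have "1 \<le> emeasure (gmeas 0) (Y a N) + ennreal (72 / real (Suc K))"
        by (meson add_right_mono order_trans)
      also have "\<dots> = ennreal (measure (gmeas 0) (Y a N) + 72 / real (Suc K))"
        unfolding emeasure_eq_measure by (subst ennreal_plus) auto
      finally show ?thesis by (simp only: ennreal_1[symmetric] ennreal_le_iff2) auto
    qed
    moreover have "(\<lambda>K. measure (gmeas 0) (Y a N) + 72 / real (Suc K)) \<longlonglongrightarrow> measure (gmeas 0) (Y a N) + 72 * 0"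
      using LIMSEQ_inverse_real_of_nat unfolding divide_inverse by (intro tendsto_intros)
    ultimately have "1 \<le> measure (gmeas 0) (Y a N)"
      by (intro LIMSEQ_le_const[of "\<lambda>K. measure (gmeas 0) (Y a N) + 72 / real (Suc K)"]) auto
    moreover have "emeasure (gmeas 0) (Y a N) \<le> 1"
      using emeasure_mono[of "Y a N" UNIV "gmeas 0"] gmeas_prob[of 0] by simp
    ultimately show ?thesis by (simp add: emeasure_eq_measure)
  qed
  have "AE x in gmeas 0. x \<in> Y a (N + 2)" for a N
  proof (rule AE_I')
    have "emeasure (gmeas 0) (UNIV - Y a (N + 2)) = emeasure (gmeas 0) UNIV - emeasure (gmeas 0) (Y a (N + 2))"
      by (rule emeasure_Diff) auto
    also have "\<dots> = 0" using full gmeas_prob[of 0] by simp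
    finally show "UNIV - Y a (N + 2) \<in> null_sets (gmeas 0)" by (simp add: null_sets_def)
  qed auto
  then have "AE x in gmeas 0. \<forall>a N. x \<in> Y a (N + 2)" by (simp add: AE_all_countable)
  moreover have "AE x in gmeas 0. x \<in> {0<..<1}" by (simp add: AE_gmeas_0)
  ultimately show ?thesis
  proof eventually_elim
    case (elim x)
    have "(SUP i\<in>{n..}. ereal (g (real (prime_digit (Suc i) x)) / digit_sum i x)) = \<infinity>" for n
    proof (rule SUP_PInfty)
      fix a :: nat
      from elim obtain i where i: "i \<ge> n + 2" "prime (digit i x)" "real (Suc a) * digit_sum i x \<le> g (real (digit i x))"
        unfolding Y_def by blast
      have S: "digit_sum i x > 0" using digit_sum_pos elim i by auto
      then have "real a * digit_sum i x \<le> g (real (digit i x))" using i(3) by (simp add: distrib_right)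
      then have "real a \<le> g (real (prime_digit (Suc i) x)) / digit_sum i x"
        using i(2) S by (simp add: prime_digit_def digit_def le_divide_eq)
      then show "\<exists>i\<in>{n..}. ereal (real a) \<le> ereal (g (real (prime_digit (Suc i) x)) / digit_sum i x)"
        using i(1) by (intro bexI[of _ i]) auto
    qed
    then show ?case by (simp add: limsup_INF_SUP)
  qed
qed

section \<open>Comparison of the series with the integral\<close>

text \<open>Up to constants the inverse function of \<open>nlog\<close>: about
  \<open>over_ln z\<close> indices \<open>i\<close> satisfy \<open>nlog i \<le> z\<close>.\<close>

definition over_ln :: "real \<Rightarrow> real" where
  "over_ln z = z / ln z"

lemma ln_ge_1: "z \<ge> 3 \<Longrightarrow> ln z \<ge> (1::real)"
  using exp_le by (subst ln_ge_iff) linarith+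

lemma over_ln_pos: "z \<ge> 3 \<Longrightarrow> over_ln z > 0"
  using ln_ge_1[of z] unfolding over_ln_def by (intro divide_pos_pos) linarith+

text \<open>\<open>z / ln z\<close> increases only from \<open>exp 1\<close> onwards; the condition
  \<open>g t > 3\<close> keeps all values in that range.\<close>

lemma over_ln_mono:
  assumes "3 \<le> a" "a \<le> b"
  shows "over_ln a \<le> over_ln b"
proof -
  have l: "ln a \<ge> 1" "ln b \<ge> 1" using assms by (auto intro: ln_ge_1)
  have "ln (b / a) \<le> b / a - 1" using assms by (intro ln_le_minus_one) auto
  then have "ln b \<le> ln a + (b / a - 1)" using assms by (simp add: ln_div)
  then have "a * ln b \<le> a * (ln a + (b / a - 1))" using assms by (intro mult_left_mono) auto
  also have "\<dots> = a * ln a + (b - a) * 1" using assms by (simp add: field_simps)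
  also have "\<dots> \<le> a * ln a + (b - a) * ln a" using assms l by (intro add_left_mono mult_left_mono) auto
  finally have "a * ln b \<le> b * ln a" by (simp add: algebra_simps)
  then show ?thesis unfolding over_ln_def using l by (simp add: divide_le_eq le_divide_eq)
qed

text \<open>Lets comparability of values of \<open>g\<close> pass to \<open>g / ln g\<close> with
  the same constant.\<close>

lemma over_ln_scale:
  assumes "3 \<le> a" "1 \<le> k" "b \<le> k * a" "3 \<le> b"
  shows "over_ln b \<le> k * over_ln a"
proof -
  have ka: "a \<le> k * a" using assms by simp
  have l: "ln a \<ge> 1" using assms by (intro ln_ge_1) auto
  have "over_ln b \<le> over_ln (k * a)" using assms by (intro over_ln_mono) auto
  also have "\<dots> \<le> k * a / ln a"
    unfolding over_ln_def using l ka assms by (intro divide_left_mono) auto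
  finally show ?thesis by (simp add: over_ln_def)
qed

section \<open>Counting indices below a level\<close>

definition nlog_count :: "real \<Rightarrow> real \<Rightarrow> nat" where
  "nlog_count e z = card {i. e * nlog i \<le> z}"

lemma nlog_le_imp:
  assumes e: "e > 0" and z: "z \<ge> 3" and i: "e * nlog i \<le> z"
  shows "real i + 1 \<le> (2 + 2 / e) * over_ln z"
proof -
  define n where "n = real i + 1"
  have n: "n \<ge> 1" by (simp add: n_def)
  have lz: "ln z \<ge> 1" using z by (rule ln_ge_1)
  have sq: "sqrt z * sqrt z = z" "sqrt z > 0" using z by auto
  have lnsq: "ln (sqrt z) = ln z / 2" using z by (simp add: ln_sqrt)
  \<comment> \<open>Split at \<open>sqrt z\<close>: below it, \<open>ln z \<le> 2 * sqrt z\<close>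
    is enough; above it, \<open>ln n\<close> is at least half of \<open>ln z\<close>. The two cases
    give the two summands of \<open>2 + 2 / e\<close>.\<close>
  have "n \<le> 2 * over_ln z \<or> n \<le> 2 / e * over_ln z"
  proof (cases "n \<le> sqrt z")
    case True
    have "ln z \<le> 2 * sqrt z" using ln_le_minus_one[of "sqrt z"] sq lnsq by simp
    then have "sqrt z * ln z \<le> 2 * z" using sq mult_left_mono[of "ln z" "2 * sqrt z" "sqrt z"]
      by (simp only: mult.left_commute[of "sqrt z" 2])
    then have "sqrt z \<le> 2 * over_ln z" using lz by (simp add: over_ln_def le_divide_eq)
    then show ?thesis using True by simp
  next
    case False
    then have "ln z / 2 \<le> ln n" unfolding lnsq[symmetric] using sq by (intro ln_mono) auto
    then have "n * (ln z / 2) \<le> n * ln n" using n by (intro mult_left_mono) auto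
    then have "e * (n * (ln z / 2)) \<le> z"
      using i e unfolding nlog_def n_def by (smt (verit) mult_left_mono)
    then have "n \<le> 2 / e * over_ln z" using lz e by (simp add: over_ln_def field_simps)
    then show ?thesis by simp
  qed
  moreover have "2 / e * over_ln z \<ge> 0" "over_ln z \<ge> 0" using e over_ln_pos[OF z] by auto
  ultimately show ?thesis unfolding n_def[symmetric] distrib_right by linarith
qed

lemma nlog_le_subset:
  assumes e: "e > 0" and z: "z \<ge> 3"
  shows "{i. e * nlog i \<le> z} \<subseteq> {..<nat \<lfloor>(2 + 2 / e) * over_ln z\<rfloor>}"
proof
  fix i assume "i \<in> {i. e * nlog i \<le> z}"
  then have "real i + 1 \<le> (2 + 2 / e) * over_ln z" using nlog_le_imp[OF e z] by simp
  then have "int i + 1 \<le> \<lfloor>(2 + 2 / e) * over_ln z\<rfloor>" by (simp add: le_floor_iff)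
  then show "i \<in> {..<nat \<lfloor>(2 + 2 / e) * over_ln z\<rfloor>}" by (simp add: zless_nat_eq_int_zless)
qed

lemma finite_nlog_le: "e > 0 \<Longrightarrow> z \<ge> 3 \<Longrightarrow> finite {i. e * nlog i \<le> z}"
  using nlog_le_subset finite_subset by blast

lemma nlog_count_upper:
  assumes e: "e > 0" and z: "z \<ge> 3"
  shows "real (nlog_count e z) \<le> (2 + 2 / e) * over_ln z"
proof -
  have "nlog_count e z \<le> nat \<lfloor>(2 + 2 / e) * over_ln z\<rfloor>"
    unfolding nlog_count_def using card_mono[OF _ nlog_le_subset[OF e z]] by simp
  moreover have "(2 + 2 / e) * over_ln z \<ge> 0" using e over_ln_pos[OF z] by (intro mult_nonneg_nonneg) auto
  ultimately show ?thesis using of_nat_floor[of "(2 + 2 / e) * over_ln z"]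
    by (meson of_nat_le_iff order_trans)
qed

lemma nlog_count_lower:
  assumes M: "M \<ge> 1" and z: "z \<ge> 3"
  shows "over_ln z \<le> 2 * M * real (nlog_count M z)"
proof -
  define X where "X = over_ln z / M"
  have lz: "ln z \<ge> 1" using z by (rule ln_ge_1)
  have "M * nlog i \<le> z" if i: "real i + 1 \<le> X" for i
  proof -
    have "z * 1 \<le> z * (M * ln z)" using M lz z mult_mono[of 1 M 1 "ln z"] by (intro mult_left_mono) auto
    then have "X \<le> z" unfolding X_def over_ln_def using M lz by (simp add: divide_le_eq mult_ac)
    then have "ln (real i + 1) \<le> ln z" using i by simp
    then have "(real i + 1) * ln (real i + 1) \<le> X * ln z" using i by (intro mult_mono) auto
    then have "M * nlog i \<le> M * (X * ln z)" unfolding nlog_def using M by (intro mult_left_mono) auto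
    also have "\<dots> = z" unfolding X_def over_ln_def using M lz by simp
    finally show ?thesis .
  qed
  then have "{..<nat \<lfloor>X\<rfloor>} \<subseteq> {i. M * nlog i \<le> z}"
    by (auto simp: zless_nat_eq_int_zless less_floor_iff)
  then have 1: "nat \<lfloor>X\<rfloor> \<le> nlog_count M z"
    unfolding nlog_count_def using card_mono[OF finite_nlog_le, of M z "{..<nat \<lfloor>X\<rfloor>}"] M z by simp
  \<comment> \<open>\<open>nlog 0 = 0\<close>, so the index 0 is always counted. This covers small
    \<open>X\<close> and pays for the loss in the floor, at the price of the factor 2.\<close>
  have "{0} \<subseteq> {i. M * nlog i \<le> z}" using z by (simp add: nlog_def)
  then have 2: "1 \<le> nlog_count M z"
    unfolding nlog_count_def using card_mono[OF finite_nlog_le, of M z "{0}"] M z by simp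
  have "X < real (nat \<lfloor>X\<rfloor>) + 1" by linarith
  then have "X \<le> 2 * real (nlog_count M z)" using 1 2 by linarith
  then show ?thesis using M by (simp add: X_def divide_le_eq mult_ac)
qed

section \<open>Weights comparable on blocks\<close>

lemma sum_blocks:
  fixes a :: "nat \<Rightarrow> real"
  assumes a: "\<And>m. \<not> prime m \<Longrightarrow> a m = 0"
  shows "sum a {16 ^ j0<..16 ^ (j0 + n)} = (\<Sum>i<n. sum a (prime_block (j0 + i)))"
proof (induction n)
  case 0 show ?case by simp
next
  case (Suc n)
  have "(16::nat) ^ j0 \<le> 16 ^ (j0 + n)" "(16::nat) ^ (j0 + n) \<le> 16 ^ (j0 + Suc n)"
    by (rule power_increasing; simp)+
  then have "{16 ^ j0<..16 ^ (j0 + Suc n)} = {16 ^ j0<..16 ^ (j0 + n)} \<union> {16 ^ (j0 + n)<..(16::nat) ^ (j0 + Suc n)}"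
    by (rule ivl_disj_un_two(6)[symmetric])
  then have "sum a {16 ^ j0<..16 ^ (j0 + Suc n)} = sum a {16 ^ j0<..16 ^ (j0 + n)} + sum a {16 ^ (j0 + n)<..16 ^ (j0 + Suc n)}"
    by (simp only:) (rule sum.union_disjoint; auto)
  also have "sum a {16 ^ (j0 + n)<..16 ^ (j0 + Suc n)} = sum a (prime_block (j0 + n))"
    by (rule sum.mono_neutral_right) (use a in \<open>auto simp: prime_block_def\<close>)
  finally show ?case using Suc by simp
qed

text \<open>The uniform form of the regularity hypothesis, with the ratio 16 of the prime blocks. It
  is applied twice: to the given \<open>g\<close>, and to a linear weight for the assertion about
  the digits themselves.\<close>

locale regular_weight =
  fixes g :: "real \<Rightarrow> real" and K T :: real
  assumes g_gt3: "\<And>t. t \<ge> 0 \<Longrightarrow> g t > 3"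
    and K: "K \<ge> 1"
    and T: "T \<ge> 1"
    and reg: "\<And>y s. T \<le> y \<Longrightarrow> y \<le> s \<Longrightarrow> s \<le> 16 * y \<Longrightarrow> g s \<le> K * g y \<and> g y \<le> K * g s"
begin

definition G :: "real \<Rightarrow> real" where "G y = over_ln (g y)"

text \<open>The common size, up to constants, of the sum of \<open>wt\<close> over block
  \<open>j\<close>, with about \<open>16 ^ j / j\<close> primes of weight about
  \<open>G (16 ^ j) / 16 ^ (2 * j)\<close>, and of the integral over the same block. Series and
  integral are compared only through it.\<close>

definition blk :: "nat \<Rightarrow> real" where "blk j = G (16 ^ j) / (16 ^ j * real j)"

definition wt :: "nat \<Rightarrow> real" where "wt m = (if prime m then G (real m) / (real m)\<^sup>2 else 0)"

definition j0 :: nat where "j0 = Suc (SOME n. T \<le> 16 ^ n)"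

lemma G_pos: "y \<ge> 0 \<Longrightarrow> G y > 0"
  unfolding G_def using g_gt3[of y] by (intro over_ln_pos) auto

lemma j0: "j0 \<ge> 1" "T \<le> 16 ^ j0"
proof -
  have "\<exists>n. T \<le> 16 ^ n" using real_arch_pow[of 16 T] by (meson less_imp_le one_less_numeral_iff semiring_norm(76))
  then have "T \<le> 16 ^ (SOME n. T \<le> 16 ^ n)" by (rule someI_ex)
  also have "\<dots> \<le> 16 ^ j0" unfolding j0_def by (rule power_increasing) auto
  finally show "T \<le> 16 ^ j0" .
qed (simp add: j0_def)

lemma blk_nonneg: "blk j \<ge> 0"
  unfolding blk_def using G_pos[of "16 ^ j"] by simp

lemma G_block:
  assumes "j \<ge> j0" "16 ^ j \<le> y" "y \<le> 16 * 16 ^ j"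
  shows "G y \<le> K * G (16 ^ j)" "G (16 ^ j) \<le> K * G y"
proof -
  have "(16::real) ^ j0 \<le> 16 ^ j" using assms by (intro power_increasing) auto
  with j0(2) have "T \<le> 16 ^ j" by (rule order_trans)
  from reg[OF this assms(2,3)] have *: "g y \<le> K * g (16 ^ j)" "g (16 ^ j) \<le> K * g y" by auto
  have "y \<ge> 0" using assms(2) by (meson order_trans zero_le_numeral zero_le_power)
  then have "3 \<le> g y" "3 \<le> g (16 ^ j)" using g_gt3[of y] g_gt3[of "16 ^ j"] by auto
  then show "G y \<le> K * G (16 ^ j)" "G (16 ^ j) \<le> K * G y"
    unfolding G_def using * K by (auto intro!: over_ln_scale)
qed

lemma wt_block_upper:
  assumes j: "j \<ge> j0"
  shows "sum wt (prime_block j) \<le> 24 * K * blk j"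
proof -
  have j1: "real j \<ge> 1" using j j0 by simp
  define q where "q = (16::real) ^ j"
  have q: "q > 0" by (simp add: q_def)
  have Gq: "G q > 0" using q by (intro G_pos) auto
  have "sum wt (prime_block j) \<le> (\<Sum>m\<in>prime_block j. K * G q / q\<^sup>2)"
  proof (rule sum_mono)
    fix m assume m: "m \<in> prime_block j"
    then have "16 ^ j \<le> m" "m \<le> 16 * 16 ^ j" by (auto simp: prime_block_def)
    then have m': "q \<le> real m" "real m \<le> 16 * q" unfolding q_def
      using of_nat_le_iff[where ?'a = real, of "16 ^ j" m] of_nat_le_iff[where ?'a = real, of m "16 * 16 ^ j"] by auto
    have "G (real m) / (real m)\<^sup>2 \<le> K * G q / q\<^sup>2"
      using G_block(1)[OF j] m' q Gq K unfolding q_def[symmetric]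
      by (intro frac_le) (auto simp: q_def[symmetric] intro: power_mono)
    then show "wt m \<le> K * G q / q\<^sup>2" using m by (simp add: wt_def prime_block_def)
  qed
  also have "\<dots> = real (card (prime_block j)) * (K * G q / q\<^sup>2)" by simp
  also have "\<dots> \<le> (24 * q / real j) * (K * G q / q\<^sup>2)"
  proof (rule mult_right_mono)
    have "real (j * card (prime_block j)) \<le> real (24 * 16 ^ j)"
      using card_prime_block_upper[of j] by (simp only: of_nat_le_iff)
    then show "real (card (prime_block j)) \<le> 24 * q / real j"
      using j1 by (simp add: q_def le_divide_eq mult.commute)
  qed (use K Gq in auto)
  also have "\<dots> = 24 * K * blk j"
    unfolding blk_def q_def[symmetric] using q j1 by (simp add: field_simps power2_eq_square)
  finally show ?thesis .
qed

text \<open>\<open>1024 = 4 * 16\<^sup>2\<close>: the block has at least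
  \<open>16 ^ j / (4 * j)\<close> primes, none larger than \<open>16 * 16 ^ j\<close>.\<close>

lemma wt_block_lower:
  assumes j: "j \<ge> j0"
  shows "blk j \<le> 1024 * K * sum wt (prime_block j)"
proof -
  have j1: "real j \<ge> 1" using j j0 by simp
  define q where "q = (16::real) ^ j"
  have q: "q > 0" by (simp add: q_def)
  have Gq: "G q > 0" using q by (intro G_pos) auto
  have "blk j = (q / (4 * real j)) * (G q / K / (16 * q)\<^sup>2) * (1024 * K)"
    unfolding blk_def q_def[symmetric] using q j1 K by (simp add: field_simps power2_eq_square)
  also have "\<dots> \<le> real (card (prime_block j)) * (G q / K / (16 * q)\<^sup>2) * (1024 * K)"
  proof (intro mult_right_mono)
    have "real (16 ^ j) \<le> real (4 * j * card (prime_block j))"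
      using card_prime_block_lower[of j] j j0 by (simp only: of_nat_le_iff)
    then show "q / (4 * real j) \<le> real (card (prime_block j))"
      using j1 by (simp add: q_def divide_le_eq mult_ac)
  qed (use K Gq in auto)
  also have "real (card (prime_block j)) * (G q / K / (16 * q)\<^sup>2) = (\<Sum>m\<in>prime_block j. G q / K / (16 * q)\<^sup>2)" by simp
  also have "\<dots> \<le> sum wt (prime_block j)"
  proof (rule sum_mono)
    fix m assume m: "m \<in> prime_block j"
    then have "16 ^ j \<le> m" "m \<le> 16 * 16 ^ j" by (auto simp: prime_block_def)
    then have m': "q \<le> real m" "real m \<le> 16 * q" unfolding q_def
      using of_nat_le_iff[where ?'a = real, of "16 ^ j" m] of_nat_le_iff[where ?'a = real, of m "16 * 16 ^ j"] by auto
    have "G q / K \<le> G (real m)"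
      using G_block(2)[OF j, of "real m"] m' K unfolding q_def[symmetric] by (simp add: divide_le_eq mult.commute)
    moreover have "G (real m) > 0" by (rule G_pos) simp
    ultimately have "G q / K / (16 * q)\<^sup>2 \<le> G (real m) / (real m)\<^sup>2"
      using m' q Gq K by (intro frac_le power_mono) auto
    then show "G q / K / (16 * q)\<^sup>2 \<le> wt m" using m by (simp add: wt_def prime_block_def)
  qed
  finally show ?thesis using K by (simp add: mult_ac)
qed

lemma wt_nonneg: "wt m \<ge> 0"
  using G_pos[of "real m"] by (simp add: wt_def)

lemma summable_wt_iff: "summable wt \<longleftrightarrow> summable blk"
proof
  assume s: "summable wt"
  have "summable (\<lambda>i. blk (i + j0))"
  proof (rule summableI_nonneg_bounded)
    fix n
    have "(\<Sum>i<n. blk (i + j0)) \<le> (\<Sum>i<n. 1024 * K * sum wt (prime_block (j0 + i)))"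
      using wt_block_lower by (intro sum_mono) (simp add: add.commute)
    also have "\<dots> = 1024 * K * sum wt {16 ^ j0<..16 ^ (j0 + n)}"
      by (subst sum_blocks) (auto simp: wt_def sum_distrib_left)
    also have "\<dots> \<le> 1024 * K * suminf wt"
      using K s wt_nonneg by (intro mult_left_mono sum_le_suminf) auto
    finally show "(\<Sum>i<n. blk (i + j0)) \<le> 1024 * K * suminf wt" .
  qed (rule blk_nonneg)
  then show "summable blk" by simp
next
  assume s: "summable blk"
  then have s': "summable (\<lambda>i. blk (i + j0))" by simp
  show "summable wt"
  proof (rule summableI_nonneg_bounded)
    fix n :: nat
    have "n < 2 ^ n" by (rule less_exp)
    also have "(2::nat) ^ n \<le> 16 ^ n" by (rule power_mono) auto
    also have "(16::nat) ^ n \<le> 16 ^ (j0 + n)" by (rule power_increasing) auto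
    finally have "{..<n} \<subseteq> {..16 ^ j0} \<union> {16 ^ j0<..16 ^ (j0 + n)}" by auto
    then have "sum wt {..<n} \<le> sum wt ({..16 ^ j0} \<union> {16 ^ j0<..16 ^ (j0 + n)})"
      using wt_nonneg by (intro sum_mono2) auto
    also have "\<dots> = sum wt {..16 ^ j0} + sum wt {16 ^ j0<..16 ^ (j0 + n)}"
      by (intro sum.union_disjoint) auto
    also have "sum wt {16 ^ j0<..16 ^ (j0 + n)} = (\<Sum>i<n. sum wt (prime_block (j0 + i)))"
      by (rule sum_blocks) (simp add: wt_def)
    also have "\<dots> \<le> (\<Sum>i<n. 24 * K * blk (i + j0))"
      using wt_block_upper by (intro sum_mono) (simp add: add.commute)
    also have "\<dots> \<le> 24 * K * (\<Sum>i. blk (i + j0))"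
      unfolding sum_distrib_left[symmetric] using K s' blk_nonneg
      by (intro mult_left_mono sum_le_suminf) auto
    finally show "sum wt {..<n} \<le> sum wt {..16 ^ j0} + 24 * K * (\<Sum>i. blk (i + j0))" by simp
  qed (rule wt_nonneg)
qed

lemma sum_exceed_indicator:
  "(\<Sum>i<n. if m \<in> prime_exceed g (e * nlog i) then 1 / (real m)\<^sup>2 else 0)
    = (if prime m then real (card {i\<in>{..<n}. e * nlog i \<le> g (real m)}) / (real m)\<^sup>2 else 0)"
proof -
  have "(\<Sum>i<n. if m \<in> prime_exceed g (e * nlog i) then 1 / (real m)\<^sup>2 else 0)
     = (\<Sum>i\<in>{i\<in>{..<n}. m \<in> prime_exceed g (e * nlog i)}. 1 / (real m)\<^sup>2)"
    by (subst sum.inter_filter) auto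
  then show ?thesis by (auto simp: prime_exceed_def)
qed

text \<open>After interchanging the sums, a prime \<open>m\<close> occurs for the indices with
  \<open>e * nlog i \<le> g m\<close>, whose number is at most a multiple of
  \<open>G m\<close>.\<close>

lemma summable_exceed:
  assumes s: "summable wt" and e: "e > 0"
  shows "summable (\<lambda>i. inv_sq_sum (prime_exceed g (e * nlog i)))"
proof (rule summableI_nonneg_bounded)
  fix n
  let ?f = "\<lambda>i m. if m \<in> prime_exceed g (e * nlog i) then 1 / (real m)\<^sup>2 else 0"
  have "(\<Sum>i<n. inv_sq_sum (prime_exceed g (e * nlog i))) = (\<Sum>m. \<Sum>i<n. ?f i m)"
    unfolding inv_sq_sum_def by (rule suminf_sum[symmetric]) (rule summable_inv_sq)
  also have "\<dots> \<le> (\<Sum>m. (2 + 2 / e) * wt m)"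
  proof (rule suminf_le)
    show "summable (\<lambda>m. \<Sum>i<n. ?f i m)" by (intro summable_sum summable_inv_sq)
    show "summable (\<lambda>m. (2 + 2 / e) * wt m)" using s by (rule summable_mult)
    fix m
    have g3: "g (real m) \<ge> 3" using g_gt3[of "real m"] by simp
    have "card {i\<in>{..<n}. e * nlog i \<le> g (real m)} \<le> nlog_count e (g (real m))"
      unfolding nlog_count_def using finite_nlog_le[OF e g3] by (intro card_mono) auto
    then have "real (card {i\<in>{..<n}. e * nlog i \<le> g (real m)}) \<le> (2 + 2 / e) * G (real m)"
      using nlog_count_upper[OF e g3] unfolding G_def by linarith
    then show "(\<Sum>i<n. ?f i m) \<le> (2 + 2 / e) * wt m"
      unfolding sum_exceed_indicator by (auto simp: wt_def divide_right_mono)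
  qed
  finally show "(\<Sum>i<n. inv_sq_sum (prime_exceed g (e * nlog i))) \<le> (\<Sum>m. (2 + 2 / e) * wt m)" .
qed (rule inv_sq_sum_nonneg)

lemma not_summable_exceed:
  assumes s: "\<not> summable wt" and M0: "M0 > 0"
  shows "\<not> summable (\<lambda>i. inv_sq_sum (prime_exceed g (M0 * nlog i)))"
proof
  \<comment> \<open>\<open>nlog_count_lower\<close> asks for a factor of at least 1; raising
    \<open>M0\<close> only shrinks the set of admissible indices.\<close>
  define M where "M = max M0 1"
  have M: "M \<ge> 1" "M0 \<le> M" by (auto simp: M_def)
  let ?f = "\<lambda>i m. if m \<in> prime_exceed g (M0 * nlog i) then 1 / (real m)\<^sup>2 else 0"
  assume u: "summable (\<lambda>i. inv_sq_sum (prime_exceed g (M0 * nlog i)))"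
  have "summable wt"
  proof (rule summableI_nonneg_bounded)
    fix J
    have g3: "g (real m) \<ge> 3" for m using g_gt3[of "real m"] by simp
    \<comment> \<open>For the primes below \<open>J\<close> only finitely many indices occur, so
      finite partial sums in both variables can be interchanged.\<close>
    have "finite (\<Union>m<J. {i. M * nlog i \<le> g (real m)})"
      using finite_nlog_le M g3 by auto
    then obtain n where n: "(\<Union>m<J. {i. M * nlog i \<le> g (real m)}) \<subseteq> {..<n}"
      using finite_nat_iff_bounded by blast
    have "sum wt {..<J} \<le> (\<Sum>m<J. 2 * M * (\<Sum>i<n. ?f i m))"
    proof (rule sum_mono)
      fix m assume m: "m \<in> {..<J}"
      have "{i. M * nlog i \<le> g (real m)} \<subseteq> {i\<in>{..<n}. M0 * nlog i \<le> g (real m)}"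
      proof
        fix i assume i: "i \<in> {i. M * nlog i \<le> g (real m)}"
        have "M0 * nlog i \<le> M * nlog i" using M by (intro mult_right_mono) (auto simp: nlog_def)
        then show "i \<in> {i\<in>{..<n}. M0 * nlog i \<le> g (real m)}" using i n m by auto
      qed
      then have "nlog_count M (g (real m)) \<le> card {i\<in>{..<n}. M0 * nlog i \<le> g (real m)}"
        unfolding nlog_count_def by (intro card_mono) auto
      then have "2 * M * real (nlog_count M (g (real m))) \<le> 2 * M * real (card {i\<in>{..<n}. M0 * nlog i \<le> g (real m)})"
        using M by (intro mult_left_mono) auto
      then have "G (real m) \<le> 2 * M * real (card {i\<in>{..<n}. M0 * nlog i \<le> g (real m)})"
        using nlog_count_lower[OF M(1) g3[of m]] unfolding G_def by linarith
      then show "wt m \<le> 2 * M * (\<Sum>i<n. ?f i m)"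
        unfolding sum_exceed_indicator by (auto simp: wt_def intro: divide_right_mono[of _ _ "(real m)\<^sup>2"])
    qed
    also have "\<dots> = 2 * M * (\<Sum>i<n. \<Sum>m<J. ?f i m)"
      by (subst sum.swap) (simp add: sum_distrib_left)
    also have "\<dots> \<le> 2 * M * (\<Sum>i<n. inv_sq_sum (prime_exceed g (M0 * nlog i)))"
      unfolding inv_sq_sum_def using M
      by (intro mult_left_mono sum_mono sum_le_suminf summable_inv_sq) auto
    also have "\<dots> \<le> 2 * M * (\<Sum>i. inv_sq_sum (prime_exceed g (M0 * nlog i)))"
      using M u inv_sq_sum_nonneg by (intro mult_left_mono sum_le_suminf) auto
    finally show "sum wt {..<J} \<le> 2 * M * (\<Sum>i. inv_sq_sum (prime_exceed g (M0 * nlog i)))" .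
  qed (rule wt_nonneg)
  then show False using s by simp
qed

lemma AE_ratio_tendsto_0:
  assumes "summable blk"
  shows "AE x in gmeas 0. (\<lambda>i. g (real (prime_digit (Suc i) x)) / digit_sum i x) \<longlonglongrightarrow> 0"
proof (rule AE_tendsto_0)
  show "g t > 0" if "t \<ge> 0" for t using g_gt3[OF that] by simp
  show "summable (\<lambda>i. inv_sq_sum (prime_exceed g (e * nlog i)))" if "e > 0" for e
    using summable_exceed[OF _ that] assms summable_wt_iff by blast
qed

lemma AE_ratio_limsup_infinity:
  assumes "\<not> summable blk"
  shows "AE x in gmeas 0. limsup (\<lambda>i. ereal (g (real (prime_digit (Suc i) x)) / digit_sum i x)) = \<infinity>"
  using not_summable_exceed assms summable_wt_iff by (intro AE_limsup_infinity) blast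

section \<open>The integral over blocks\<close>

definition integrand :: "real \<Rightarrow> real" where
  "integrand y = g y / ln (g y) / (y\<^sup>2 * ln y)"

lemma integrand_eq: "integrand y = G y / (y\<^sup>2 * ln y)"
  by (simp add: integrand_def G_def over_ln_def)

lemma ln_16: "1 \<le> ln (16::real)" "ln (16::real) \<le> 15"
  using ln_ge_1[of 16] ln_le_minus_one[of "16::real"] by auto

lemma integral_block_upper:
  assumes j: "j \<ge> j0"
  shows "(\<integral>\<^sup>+y\<in>{16 ^ j<..16 ^ Suc j}. ennreal (integrand y) \<partial>lborel) \<le> ennreal (15 * K * blk j)"
proof -
  have j1: "real j \<ge> 1" using j j0 by simp
  define q where "q = (16::real) ^ j"
  have q: "q > 0" by (simp add: q_def)
  have Gq: "G q > 0" using q by (intro G_pos) auto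
  define C where "C = K * G q / (q\<^sup>2 * real j)"
  have C0: "C \<ge> 0" using K Gq by (simp add: C_def)
  have "(\<integral>\<^sup>+y\<in>{16 ^ j<..16 ^ Suc j}. ennreal (integrand y) \<partial>lborel) \<le> (\<integral>\<^sup>+y\<in>{(16::real) ^ j<..16 ^ Suc j}. ennreal C \<partial>lborel)"
  proof (intro nn_integral_mono)
    fix y :: real
    have "integrand y \<le> C" if y: "y \<in> {16 ^ j<..16 ^ Suc j}"
    proof -
      have y': "q \<le> y" "y \<le> 16 * q" using y by (auto simp: q_def)
      have "real j * 1 \<le> real j * ln 16" using ln_16 by (intro mult_left_mono) auto
      also have "\<dots> = ln q" by (simp add: q_def ln_realpow)
      also have "\<dots> \<le> ln y" using y' q by simp
      finally have "real j \<le> ln y" by simp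
      then have "q\<^sup>2 * real j \<le> y\<^sup>2 * ln y" using y' q by (intro mult_mono power_mono) auto
      then show ?thesis unfolding integrand_eq C_def
        using G_block(1)[OF j, of y] y' q Gq K j1 unfolding q_def[symmetric] by (intro frac_le) auto
    qed
    then show "ennreal (integrand y) * indicator {16 ^ j<..16 ^ Suc j} y \<le> ennreal C * indicator {16 ^ j<..16 ^ Suc j} y"
      by (auto split: split_indicator intro: ennreal_leI)
  qed
  also have "\<dots> = ennreal C * ennreal (15 * q)"
    by (subst nn_integral_cmult_indicator) (auto simp: q_def)
  also have "\<dots> = ennreal (15 * K * blk j)"
    unfolding blk_def q_def[symmetric] C_def using q j1 K Gq
    by (subst ennreal_mult[symmetric]) (auto simp: field_simps power2_eq_square)
  finally show ?thesis .
qed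

text \<open>\<open>512 = 16\<^sup>2 * 2\<close>: the square comes from
  \<open>y \<le> 16 * q\<close>, the 2 from
  \<open>ln y \<le> (j + 1) * ln 16 \<le> 2 * j * 15\<close>. The crude bound 15 for
  \<open>ln 16\<close> cancels against the length \<open>15 * q\<close> of the block.\<close>

lemma integral_block_lower:
  assumes j: "j \<ge> j0"
  shows "ennreal (blk j / (512 * K)) \<le> (\<integral>\<^sup>+y\<in>{16 ^ j<..16 ^ Suc j}. ennreal (integrand y) \<partial>lborel)"
proof -
  have j1: "real j \<ge> 1" using j j0 by simp
  define q where "q = (16::real) ^ j"
  have q: "q \<ge> 1" by (simp add: q_def)
  have Gq: "G q > 0" using q by (intro G_pos) auto
  define C where "C = (G q / K) / ((16 * q)\<^sup>2 * (2 * real j * 15))"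
  have C0: "C \<ge> 0" using K Gq by (simp add: C_def)
  have "ennreal (blk j / (512 * K)) = ennreal C * ennreal (15 * q)"
    unfolding blk_def q_def[symmetric] C_def using q j1 K Gq
    by (subst ennreal_mult[symmetric]) (auto simp: field_simps power2_eq_square)
  also have "\<dots> = (\<integral>\<^sup>+y\<in>{(16::real) ^ j<..16 ^ Suc j}. ennreal C \<partial>lborel)"
    by (subst nn_integral_cmult_indicator) (auto simp: q_def)
  also have "\<dots> \<le> (\<integral>\<^sup>+y\<in>{16 ^ j<..16 ^ Suc j}. ennreal (integrand y) \<partial>lborel)"
  proof (intro nn_integral_mono)
    fix y :: real
    have "C \<le> integrand y" if y: "y \<in> {16 ^ j<..16 ^ Suc j}"
    proof -
      have y': "q < y" "y \<le> 16 * q" using y by (auto simp: q_def)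
      have "ln y \<le> ln (16 ^ Suc j)" using y' q by (subst ln_le_cancel_iff) (auto simp: q_def)
      also have "\<dots> = (real j + 1) * ln 16" by (subst ln_realpow) auto
      also have "\<dots> \<le> (2 * real j) * 15" using ln_16 j1 by (intro mult_mono) auto
      finally have ly: "ln y \<le> 2 * real j * 15" .
      have ly0: "ln y > 0" using y' q by simp
      have "y\<^sup>2 * ln y \<le> (16 * q)\<^sup>2 * (2 * real j * 15)"
        using y' q ly ly0 by (intro mult_mono power_mono) auto
      moreover have "G q / K \<le> G y"
        using G_block(2)[OF j, of y] y' K unfolding q_def[symmetric] by (simp add: divide_le_eq mult.commute)
      moreover have "0 < y\<^sup>2 * ln y" using y' q ly0 by simp
      moreover have "G y > 0" using y' q by (intro G_pos) auto
      ultimately show ?thesis unfolding integrand_eq C_def using Gq K by (intro frac_le) auto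
    qed
    then show "ennreal C * indicator {16 ^ j<..16 ^ Suc j} y \<le> ennreal (integrand y) * indicator {16 ^ j<..16 ^ Suc j} y"
      by (auto split: split_indicator intro: ennreal_leI)
  qed
  finally show ?thesis .
qed

lemma integral_tail_blocks:
  assumes meas: "g \<in> borel_measurable (restrict_space lborel {0..})"
  shows "(\<integral>\<^sup>+y\<in>{16 ^ j..}. ennreal (integrand y) \<partial>lborel)
     = (\<Sum>i. \<integral>\<^sup>+y\<in>{16 ^ (j + i)<..16 ^ Suc (j + i)}. ennreal (integrand y) \<partial>lborel)"
proof -
  define A where "A = (\<lambda>i. {(16::real) ^ (j + i)<..16 ^ Suc (j + i)})"
  \<comment> \<open>\<open>g\<close> is measurable on the nonnegative axis only; the constant
    extension gives a Borel function on the line that agrees with \<open>g\<close> on all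
    blocks.\<close>
  define g' where "g' = (\<lambda>y. if y \<in> {0..} then g y else 4)"
  define f where "f = (\<lambda>y. g' y / ln (g' y) / (y\<^sup>2 * ln y))"
  have [measurable]: "g' \<in> borel_measurable borel"
  proof -
    have "g' \<in> measurable lborel borel"
      unfolding g'_def using meas
      by (subst measurable_If_restrict_space_iff) (auto simp: Collect_mem_eq simp del: atLeast_iff)
    then show ?thesis by simp
  qed
  have [measurable]: "f \<in> borel_measurable borel" unfolding f_def by measurable
  have [measurable]: "A i \<in> sets borel" for i by (simp add: A_def)
  have pos: "(0::real) < 16 ^ n" for n by simp
  have f_eq: "f y = integrand y" if "y \<ge> 0" for y using that by (simp add: f_def g'_def integrand_def)
  have disj: "disjoint_family A"
    unfolding disjoint_family_on_def
  proof (intro ballI impI)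
    have *: "A m \<inter> A n = {}" if "m < n" for m n
    proof -
      have "(16::real) ^ Suc (j + m) \<le> 16 ^ (j + n)" using that by (intro power_increasing) auto
      then show ?thesis unfolding A_def by auto
    qed
    fix m n :: nat assume "m \<noteq> n"
    then show "A m \<inter> A n = {}" using *[of m n] *[of n m] by (auto simp: neq_iff)
  qed
  have U: "(\<Union>i. A i) = {16 ^ j<..}"
  proof (intro set_eqI iffI)
    fix y assume "y \<in> (\<Union>i. A i)"
    then obtain i where "y > 16 ^ (j + i)" by (auto simp: A_def)
    moreover have "(16::real) ^ j \<le> 16 ^ (j + i)" by (intro power_increasing) auto
    ultimately show "y \<in> {16 ^ j<..}" unfolding greaterThan_iff by linarith
  next
    fix y :: real assume y: "y \<in> {16 ^ j<..}"
    obtain n0 where "y < 16 ^ n0" using real_arch_pow[of 16 y] by auto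
    moreover have "(16::real) ^ n0 \<le> 16 ^ (j + n0)" by (intro power_increasing) auto
    ultimately have "y \<le> 16 ^ (j + n0)" by (meson less_imp_le order_trans)
    then have ex: "\<exists>n. y \<le> 16 ^ (j + n)" ..
    define n where "n = (LEAST n. y \<le> 16 ^ (j + n))"
    have n: "y \<le> 16 ^ (j + n)" unfolding n_def by (rule LeastI_ex[OF ex])
    with y have "n \<noteq> 0" by (auto intro!: Nat.gr0I)
    then obtain i where i: "n = Suc i" by (cases n) auto
    have "\<not> y \<le> 16 ^ (j + i)" using not_less_Least[of i "\<lambda>n. y \<le> 16 ^ (j + n)"] i n_def by auto
    then have "y \<in> A i" using n i by (simp add: A_def)
    then show "y \<in> (\<Union>i. A i)" by blast
  qed
  have "(\<integral>\<^sup>+y\<in>{16 ^ j..}. ennreal (integrand y) \<partial>lborel) = (\<integral>\<^sup>+y. ennreal (f y) * indicator {16 ^ j<..} y \<partial>lborel)"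
  proof (rule nn_integral_cong_AE)
    show "AE y in lborel. ennreal (integrand y) * indicator {16 ^ j..} y = ennreal (f y) * indicator {16 ^ j<..} y"
      using AE_lborel_singleton[of "16 ^ j"]
    proof eventually_elim
      case (elim y)
      have "y \<ge> 0" if "16 ^ j \<le> y" using that pos[of j] by linarith
      then show ?case using elim f_eq[of y] by (auto split: split_indicator)
    qed
  qed
  also have "\<dots> = (\<integral>\<^sup>+y. (\<Sum>i. ennreal (f y) * indicator (A i) y) \<partial>lborel)"
    by (simp add: suminf_indicator[OF disj] U)
  also have "\<dots> = (\<Sum>i. \<integral>\<^sup>+y. ennreal (f y) * indicator (A i) y \<partial>lborel)"
    by (rule nn_integral_suminf) measurable
  also have "\<dots> = (\<Sum>i. \<integral>\<^sup>+y\<in>{16 ^ (j + i)<..16 ^ Suc (j + i)}. ennreal (integrand y) \<partial>lborel)"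
  proof (intro suminf_cong nn_integral_cong)
    fix i and y :: real
    have "y \<ge> 0" if "16 ^ (j + i) < y" using that pos[of "j + i"] by linarith
    then show "ennreal (f y) * indicator (A i) y = ennreal (integrand y) * indicator {16 ^ (j + i)<..16 ^ Suc (j + i)} y"
      using f_eq[of y] by (auto simp: A_def split: split_indicator)
  qed
  finally show ?thesis .
qed

lemma integral_infinite_iff:
  assumes meas: "g \<in> borel_measurable (restrict_space lborel {0..})" and c: "c \<ge> 16 ^ j0"
  shows "(\<integral>\<^sup>+y\<in>{c..}. ennreal (integrand y) \<partial>lborel) = \<infinity> \<longleftrightarrow> \<not> summable blk"
proof
  assume inf: "(\<integral>\<^sup>+y\<in>{c..}. ennreal (integrand y) \<partial>lborel) = \<infinity>"
  show "\<not> summable blk"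
  proof
    assume "summable blk"
    then have s: "summable (\<lambda>i. 15 * K * blk (i + j0))" by (intro summable_mult) simp
    have "(\<integral>\<^sup>+y\<in>{c..}. ennreal (integrand y) \<partial>lborel) \<le> (\<integral>\<^sup>+y\<in>{16 ^ j0..}. ennreal (integrand y) \<partial>lborel)"
      using c by (intro nn_integral_mono) (auto split: split_indicator)
    also have "\<dots> \<le> (\<Sum>i. ennreal (15 * K * blk (i + j0)))"
      unfolding integral_tail_blocks[OF meas]
      by (intro suminf_le summableI) (subst add.commute, rule integral_block_upper, simp)
    also have "\<dots> = ennreal (\<Sum>i. 15 * K * blk (i + j0))"
      using s K blk_nonneg by (intro suminf_ennreal2) auto
    finally show False using inf by (simp add: top_unique)
  qed
next
  assume ns: "\<not> summable blk"
  \<comment> \<open>\<open>c\<close> may lie inside a block, so the lower bound starts at a power of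
    16 beyond it; dropping finitely many terms of \<open>blk\<close> preserves divergence.\<close>
  obtain n where n: "c < 16 ^ n" using real_arch_pow[of 16 c] by auto
  define j where "j = max n j0"
  have j: "j \<ge> j0" "c \<le> 16 ^ j"
  proof -
    have "(16::real) ^ n \<le> 16 ^ j" unfolding j_def by (intro power_increasing) auto
    with n show "c \<le> 16 ^ j" by (meson less_imp_le order_trans)
  qed (simp add: j_def)
  have "(\<Sum>i. ennreal (blk (i + j) / (512 * K))) = top"
  proof (rule ccontr)
    assume "\<not> ?thesis"
    then have "summable (\<lambda>i. blk (i + j) / (512 * K))"
      using blk_nonneg K by (intro summable_suminf_not_top) auto
    then have "summable (\<lambda>i. blk (i + j))" using K by simp
    then show False using ns by simp
  qed
  moreover have "(\<Sum>i. ennreal (blk (i + j) / (512 * K))) \<le> (\<integral>\<^sup>+y\<in>{16 ^ j..}. ennreal (integrand y) \<partial>lborel)"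
    unfolding integral_tail_blocks[OF meas]
    by (intro suminf_le summableI) (subst (1) add.commute, rule integral_block_lower, use j in simp)
  moreover have "\<dots> \<le> (\<integral>\<^sup>+y\<in>{c..}. ennreal (integrand y) \<partial>lborel)"
    using j by (intro nn_integral_mono) (auto split: split_indicator)
  ultimately show "(\<integral>\<^sup>+y\<in>{c..}. ennreal (integrand y) \<partial>lborel) = \<infinity>"
    by (simp add: top_unique)
qed

end

section \<open>Uniformity from the asymptotic hypothesis\<close>

lemma asymp_comparable_bounded:
  assumes "asymp_comparable f h"
  shows "\<exists>C::nat. eventually (\<lambda>t. f t / h t < real C) at_top"
proof -
  have "Limsup at_top (\<lambda>t. ereal (f t / h t)) \<noteq> \<infinity>"
    using assms by (auto simp: asymp_comparable_def)
  then obtain C :: nat where "Limsup at_top (\<lambda>t. ereal (f t / h t)) < ereal (real C)"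
    unfolding less_PInf_Ex_of_nat by blast
  from Limsup_lessD[OF this] show ?thesis by auto
qed

text \<open>Otherwise there are \<open>tt n\<close> tending to infinity and \<open>ss n\<close>,
  relatively closer and closer to them, with \<open>g (ss n) > Suc n * g (tt n)\<close>. One
  function that moves each \<open>tt n\<close> to such a point and fixes everything else is
  asymptotic to the identity, yet the ratio along it is unbounded.\<close>

lemma asymp_comparable_imp_locally_bounded:
  fixes g :: "real \<Rightarrow> real"
  assumes g: "\<And>t. t \<ge> 0 \<Longrightarrow> g t > 0"
    and g_reg: "\<And>\<eta> :: real \<Rightarrow> real. \<eta> \<sim>[at_top] (\<lambda>t. t) \<Longrightarrow> asymp_comparable (\<lambda>t. g (\<eta> t)) g"
  shows "\<exists>N::nat. \<forall>t\<ge>real (Suc N). \<forall>s. \<bar>s - t\<bar> \<le> t / real (Suc N) \<longrightarrow> g s \<le> real (Suc N) * g t"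
proof (rule ccontr)
  assume "\<not> ?thesis"
  then have "\<forall>n. \<exists>t s. t \<ge> real (Suc n) \<and> \<bar>s - t\<bar> \<le> t / real (Suc n) \<and> g s > real (Suc n) * g t"
    by (meson not_le)
  then obtain tt ss where ts: "\<And>n. tt n \<ge> real (Suc n)" "\<And>n. \<bar>ss n - tt n\<bar> \<le> tt n / real (Suc n)"
      "\<And>n. g (ss n) > real (Suc n) * g (tt n)"
    by metis
  \<comment> \<open>Several \<open>n\<close> may share the value \<open>tt n\<close>; the least is
    chosen. Beyond the largest of the first \<open>N\<close> values every chosen index is at least
    \<open>N\<close>, so the points still get closer and the ratio still grows.\<close>
  define idx where "idx = (\<lambda>x. LEAST n. tt n = x)"
  define \<eta> where "\<eta> = (\<lambda>x. if x \<in> range tt then ss (idx x) else x)"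
  have idx: "tt (idx x) = x" if "x \<in> range tt" for x
    using that unfolding idx_def by (auto intro: LeastI)
  have large: "\<exists>X\<ge>1. \<forall>x>X. x \<in> range tt \<longrightarrow> idx x \<ge> N" for N
  proof (intro exI[of _ "Max (insert 1 (tt ` {..<N}))"] conjI allI impI)
    fix x assume x: "x > Max (insert 1 (tt ` {..<N}))" "x \<in> range tt"
    show "idx x \<ge> N"
    proof (rule ccontr)
      assume "\<not> ?thesis"
      then have "tt (idx x) \<le> Max (insert 1 (tt ` {..<N}))" by (intro Max_ge) auto
      then show False using x idx by simp
    qed
  qed simp
  have "((\<lambda>x. \<eta> x / x) \<longlongrightarrow> 1) at_top"
  proof (rule tendstoI)
    fix e :: real assume e: "e > 0"
    obtain N where N: "1 / real (Suc N) < e" using e nat_approx_posE by blast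
    obtain X where X: "X \<ge> 1" "\<And>x. x > X \<Longrightarrow> x \<in> range tt \<Longrightarrow> idx x \<ge> N" using large by blast
    show "eventually (\<lambda>x. dist (\<eta> x / x) 1 < e) at_top"
      using eventually_gt_at_top[of X]
    proof eventually_elim
      case (elim x)
      show ?case
      proof (cases "x \<in> range tt")
        case True
        have "\<bar>ss (idx x) - x\<bar> \<le> x / real (Suc (idx x))" using ts(2)[of "idx x"] idx[OF True] by simp
        then have "\<bar>ss (idx x) - x\<bar> / x \<le> 1 / real (Suc (idx x))"
          using elim X by (simp add: field_simps del: of_nat_Suc)
        also have "\<dots> \<le> 1 / real (Suc N)" using X(2)[OF elim True] by (intro divide_left_mono) auto
        also have "\<bar>ss (idx x) - x\<bar> / x = dist (\<eta> x / x) 1"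
        proof -
          have "\<eta> x / x - 1 = (ss (idx x) - x) / x" using True elim X by (simp add: \<eta>_def field_simps)
          then show ?thesis using elim X by (simp add: dist_real_def)
        qed
        finally show ?thesis using N by simp
      qed (use elim X e in \<open>auto simp: \<eta>_def\<close>)
    qed
  qed
  then have "asymp_comparable (\<lambda>t. g (\<eta> t)) g" by (intro g_reg asymp_equivI')
  then obtain C :: nat where "eventually (\<lambda>t. g (\<eta> t) / g t < real C) at_top"
    using asymp_comparable_bounded by blast
  then obtain Y where Y: "\<And>t. t \<ge> Y \<Longrightarrow> g (\<eta> t) / g t < real C"
    by (auto simp: eventually_at_top_linorder)
  obtain X where X: "X \<ge> 1" "\<And>x. x > X \<Longrightarrow> x \<in> range tt \<Longrightarrow> idx x \<ge> C" using large by blast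
  obtain n :: nat where n: "max X Y < real n" using reals_Archimedean2 by blast
  define x where "x = tt n"
  have x: "x > X" "x \<ge> Y" "x \<in> range tt" using ts(1)[of n] n by (auto simp: x_def)
  then have gx: "g x > 0" using X by (intro g) auto
  have "real C * g x \<le> real (Suc (idx x)) * g x" using X(2)[OF x(1,3)] gx by (intro mult_right_mono) auto
  also have "\<dots> < g (\<eta> x)" using ts(3)[of "idx x"] idx[OF x(3)] x(3) by (simp add: \<eta>_def)
  finally have "real C < g (\<eta> x) / g x" using gx by (simp add: less_divide_eq)
  then show False using Y[OF x(2)] by simp
qed

text \<open>A ratio up to \<open>q = 1 + 1 / Suc N\<close> costs the factor
  \<open>k = Suc N\<close>, and \<open>m\<close> such steps with \<open>q ^ m > 16\<close> cover the
  ratio 16 at the cost \<open>k ^ m\<close>. The local bound is one-sided but its window is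
  two-sided, so exchanging the two points gives the reverse inequality.\<close>

lemma regular_weight_of_asymp_comparable:
  fixes g :: "real \<Rightarrow> real"
  assumes g: "\<And>t. t \<ge> 0 \<Longrightarrow> g t > 3"
    and g_reg: "\<And>\<eta> :: real \<Rightarrow> real. \<eta> \<sim>[at_top] (\<lambda>t. t) \<Longrightarrow> asymp_comparable (\<lambda>t. g (\<eta> t)) g"
  shows "\<exists>K T. regular_weight g K T"
proof -
  have g0: "g t > 0" if "t \<ge> 0" for t using g[OF that] by simp
  obtain N :: nat where N: "\<And>t s. t \<ge> real (Suc N) \<Longrightarrow> \<bar>s - t\<bar> \<le> t / real (Suc N) \<Longrightarrow> g s \<le> real (Suc N) * g t"
    using asymp_comparable_imp_locally_bounded[OF g0 g_reg] by blast
  define q where "q = 1 + 1 / real (Suc N)"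
  define k where "k = real (Suc N)"
  have k: "k \<ge> 1" by (simp add: k_def)
  have q1: "q > 1" by (simp add: q_def)
  have step: "g s \<le> k * g y \<and> g y \<le> k * g s" if y: "y \<ge> k" and s: "y \<le> s" "s \<le> q * y" for y s
  proof -
    have d: "s - y \<le> y / k" using s by (simp add: q_def k_def algebra_simps)
    have "y / k \<le> s / k" using s k by (intro divide_right_mono) auto
    then show ?thesis using N[of y s] N[of s y] y s d unfolding k_def[symmetric] by simp
  qed
  have chain: "g s \<le> k ^ m * g y \<and> g y \<le> k ^ m * g s" if "y \<ge> k" "y \<le> s" "s \<le> q ^ m * y" for y s m
    using that
  proof (induction m arbitrary: s)
    case 0
    then show ?case by simp
  next
    case (Suc m)
    have s0: "g s > 0" "g y > 0" using Suc.prems k g0[of s] g0[of y] by auto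
    show ?case
    proof (cases "s \<le> q ^ m * y")
      case True
      have IH: "g s \<le> k ^ m * g y" "g y \<le> k ^ m * g s" using Suc.IH[OF Suc.prems(1,2) True] by auto
      have "k ^ m \<le> k ^ Suc m" using k by (intro power_increasing) auto
      then have "k ^ m * g y \<le> k ^ Suc m * g y" "k ^ m * g s \<le> k ^ Suc m * g s"
        using s0 by (auto intro: mult_right_mono)
      then show ?thesis using IH by linarith
    next
      case False
      define s' where "s' = q ^ m * y"
      have qm: "1 \<le> q ^ m" using q1 by (intro one_le_power) auto
      have y0: "y > 0" using Suc.prems k by linarith
      have s': "y \<le> s'" using qm y0 unfolding s'_def by simp
      have IH: "g s' \<le> k ^ m * g y" "g y \<le> k ^ m * g s'"
        using Suc.IH[OF Suc.prems(1) s'] by (auto simp: s'_def)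
      have st: "g s \<le> k * g s'" "g s' \<le> k * g s"
        using step[of s' s] Suc.prems s' False by (auto simp: s'_def mult.assoc)
      have "g s \<le> k * (k ^ m * g y)" using st(1) IH(1) k by (meson mult_left_mono order_trans zero_le_one)
      moreover have "g y \<le> k ^ m * (k * g s)" using IH(2) st(2) k
        by (meson mult_left_mono order_trans zero_le_one zero_le_power)
      ultimately show ?thesis by (simp add: mult_ac)
    qed
  qed
  obtain m where m: "16 < q ^ m" using real_arch_pow[OF q1] by blast
  have "regular_weight g (k ^ m) k"
  proof
    fix y s assume a: "k \<le> y" "y \<le> s" "s \<le> 16 * y"
    have "16 * y \<le> q ^ m * y" using m a k by (intro mult_right_mono) auto
    then show "g s \<le> k ^ m * g y \<and> g y \<le> k ^ m * g s" using chain a by auto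
  qed (use k g in \<open>auto intro: one_le_power\<close>)
  then show ?thesis by blast
qed

section \<open>The linear weight and the conclusion\<close>

lemma regular_weight_linear: "regular_weight (\<lambda>t. t + 4) 16 1"
  by unfold_locales auto

text \<open>The first assertion concerns the digit itself, but the identity takes values below 3;
  \<open>t + 4\<close> is admissible and dominates it. For this weight \<open>G (16 ^ j)\<close> is
  of order \<open>16 ^ j / j\<close>, so \<open>blk j\<close> is of order
  \<open>1 / j\<^sup>2\<close>.\<close>

lemma summable_blk_linear: "summable (regular_weight.blk (\<lambda>t. t + 4))"
proof -
  interpret regular_weight "\<lambda>t. t + 4" 16 1 by (rule regular_weight_linear)
  show ?thesis
  proof (rule summable_comparison_test')
    show "summable (\<lambda>j. 5 * (1 / (real j)\<^sup>2))"
      using inverse_power_summable[of 2, where ?'a = real] by (intro summable_mult) (simp add: inverse_eq_divide)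
    fix j :: nat assume j: "j \<ge> 1"
    define q where "q = (16::real) ^ j"
    have q: "q \<ge> 1" by (simp add: q_def)
    have "real j * 1 \<le> real j * ln 16" using ln_16 by (intro mult_left_mono) auto
    also have "\<dots> = ln q" by (simp add: q_def ln_realpow)
    also have "\<dots> \<le> ln (q + 4)" using q by simp
    finally have l: "real j \<le> ln (q + 4)" by simp
    have "blk j = (q + 4) / (ln (q + 4) * (q * real j))"
      by (simp add: blk_def G_def over_ln_def q_def)
    also have "\<dots> \<le> (5 * q) / (real j * (q * real j))"
      using q j l by (intro frac_le mult_right_mono) auto
    also have "\<dots> = 5 * (1 / (real j)\<^sup>2)" using q by (simp add: power2_eq_square)
    finally show "norm (blk j) \<le> 5 * (1 / (real j)\<^sup>2)" using blk_nonneg[of j] by simp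
  qed
qed

text \<open>The shift \<open>n = Suc i\<close>: \<open>digit i\<close> is the n-th digit, and
  exactly \<open>i\<close> digits precede it.\<close>

lemma digit_sum_eq: "(\<Sum>k=1..Suc i - 1. real (cf_digit k x)) = digit_sum i x"
  by (simp add: digit_sum_def digit_def sum.atLeast1_atMost_eq)

lemma AE_unit_interval_iff:
  "(AE x in lborel. x \<in> {0<..1} \<longrightarrow> P x) \<longleftrightarrow> (AE x in gmeas 0. P x)"
  unfolding AE_gmeas_0
proof
  assume "AE x in lborel. x \<in> {0<..<1} \<longrightarrow> P x"
  with AE_lborel_singleton[of "1::real"] show "AE x in lborel. x \<in> {0<..1} \<longrightarrow> P x"
    by eventually_elim auto
qed (auto elim: eventually_mono)

theorem theorem2p8:
  fixes g :: "real \<Rightarrow> real"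
  assumes g_meas: "g \<in> borel_measurable (restrict_space lborel {0..})"
    and g_gt3: "\<And>t. t \<ge> 0 \<Longrightarrow> g t > 3"
    and g_reg: "\<And>\<eta> :: real \<Rightarrow> real. \<eta> \<sim>[at_top] (\<lambda>t. t) \<Longrightarrow>
                   asymp_comparable (\<lambda>t. g (\<eta> t)) g"
  shows "(AE x in lborel. x \<in> {0<..1} \<longrightarrow>
            (\<lambda>n. real (prime_digit n x) / (\<Sum>k=1..n-1. real (cf_digit k x)))
              \<longlonglongrightarrow> 0)
      \<and> (\<exists>c0>1. \<forall>c\<ge>c0.
           ((AE x in lborel. x \<in> {0<..1} \<longrightarrow>
               limsup (\<lambda>n. ereal (g (real (prime_digit n x)) /
                                   (\<Sum>k=1..n-1. real (cf_digit k x)))) = \<infinity>)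
             \<longleftrightarrow> (\<integral>\<^sup>+ y\<in>{c..}. ennreal (g y / ln (g y) / (y\<^sup>2 * ln y)) \<partial>lborel) = \<infinity>)
         \<and> ((\<integral>\<^sup>+ y\<in>{c..}. ennreal (g y / ln (g y) / (y\<^sup>2 * ln y)) \<partial>lborel) < \<infinity> \<longrightarrow>
             (AE x in lborel. x \<in> {0<..1} \<longrightarrow>
               (\<lambda>n. g (real (prime_digit n x)) / (\<Sum>k=1..n-1. real (cf_digit k x)))
                 \<longlonglongrightarrow> 0)))"
proof -
  have lim_iff: "(\<lambda>n. h (prime_digit n x) / (\<Sum>k=1..n-1. real (cf_digit k x))) \<longlonglongrightarrow> 0
      \<longleftrightarrow> (\<lambda>i. h (prime_digit (Suc i) x) / digit_sum i x) \<longlonglongrightarrow> 0" for h :: "nat \<Rightarrow> real" and x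
    by (subst filterlim_sequentially_Suc[symmetric]) (simp only: digit_sum_eq)
  have limsup_eq: "limsup (\<lambda>n. ereal (g (real (prime_digit n x)) / (\<Sum>k=1..n-1. real (cf_digit k x))))
      = limsup (\<lambda>i. ereal (g (real (prime_digit (Suc i) x)) / digit_sum i x))" for x
    by (subst limsup_shift[symmetric]) (simp only: Suc_eq_plus1[symmetric] digit_sum_eq)
  have "AE x in gmeas 0. (\<lambda>i. real (prime_digit (Suc i) x) / digit_sum i x) \<longlonglongrightarrow> 0"
    using regular_weight.AE_ratio_tendsto_0[OF regular_weight_linear summable_blk_linear]
  proof eventually_elim
    case (elim x)
    have pos: "digit_sum i x \<ge> 0" for i by (simp add: digit_sum_def sum_nonneg)
    show ?case
    proof (rule tendsto_sandwich[OF _ _ tendsto_const elim])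
      show "eventually (\<lambda>i. real (prime_digit (Suc i) x) / digit_sum i x
          \<le> (real (prime_digit (Suc i) x) + 4) / digit_sum i x) sequentially"
        using pos by (intro always_eventually allI divide_right_mono) auto
    qed (use pos in auto)
  qed
  then have part1: "AE x in lborel. x \<in> {0<..1} \<longrightarrow>
      (\<lambda>n. real (prime_digit n x) / (\<Sum>k=1..n-1. real (cf_digit k x))) \<longlonglongrightarrow> 0"
    unfolding AE_unit_interval_iff lim_iff[of real] .
  obtain K T where "regular_weight g K T"
    using regular_weight_of_asymp_comparable[OF g_gt3 g_reg] by blast
  then interpret regular_weight g K T .
  have inf_iff: "(\<integral>\<^sup>+ y\<in>{c..}. ennreal (g y / ln (g y) / (y\<^sup>2 * ln y)) \<partial>lborel) = \<infinity> \<longleftrightarrow> \<not> summable blk"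
    if "c \<ge> 16 ^ j0" for c
    using integral_infinite_iff[OF g_meas that] unfolding integrand_def .
  have lim: "AE x in gmeas 0. (\<lambda>i. g (real (prime_digit (Suc i) x)) / digit_sum i x) \<longlonglongrightarrow> 0" if "summable blk"
    using AE_ratio_tendsto_0[OF that] .
  have limsup: "(AE x in gmeas 0. limsup (\<lambda>i. ereal (g (real (prime_digit (Suc i) x)) / digit_sum i x)) = \<infinity>)
      \<longleftrightarrow> \<not> summable blk"
  proof
    assume inf: "AE x in gmeas 0. limsup (\<lambda>i. ereal (g (real (prime_digit (Suc i) x)) / digit_sum i x)) = \<infinity>"
    show "\<not> summable blk"
    proof
      assume "summable blk"
      \<comment> \<open>Limit 0 and infinite limsup exclude each other at every point, so both can
        hold almost everywhere only if the space is null, against total mass 1.\<close>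
      from inf lim[OF this] have "AE x in gmeas 0. False"
      proof eventually_elim
        case (elim x)
        from elim(2) have "(\<lambda>i. ereal (g (real (prime_digit (Suc i) x)) / digit_sum i x)) \<longlonglongrightarrow> ereal 0"
          by (rule tendsto_ereal)
        then have "limsup (\<lambda>i. ereal (g (real (prime_digit (Suc i) x)) / digit_sum i x)) = ereal 0"
          by (intro lim_imp_Limsup) auto
        then show False using elim(1) by simp
      qed
      then have "emeasure (gmeas 0) UNIV = 0"
        by (subst (asm) AE_iff_measurable[of UNIV]) auto
      then show False using gmeas_prob[of 0] by simp
    qed
  qed (rule AE_ratio_limsup_infinity)
  \<comment> \<open>The threshold for \<open>c\<close> is \<open>16 ^ j0\<close>, from where on the
    block comparison is valid; \<open>j0 \<ge> 1\<close> makes it exceed 1.\<close>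
  have "(16::real) ^ 1 \<le> 16 ^ j0" using j0(1) by (intro power_increasing) auto
  then have c0: "(16::real) ^ j0 > 1" by (rule order.strict_trans2[rotated]) simp
  show ?thesis
    unfolding AE_unit_interval_iff limsup_eq lim_iff[of "\<lambda>m. g (real m)"] lim_iff[of real]
    using part1[unfolded AE_unit_interval_iff lim_iff[of real]] c0 limsup lim inf_iff
    by (intro conjI exI[of _ "16 ^ j0"] allI impI) (auto simp: less_top[symmetric])
qed

end
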